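(* For a permutation $\pi$ of $\{1,\dots,r\}$ let $m^\pi\in\mathbb{Z}^r$ be the vector $$m^\pi_k=\Bigl(1+\sum_{j:\,\pi(j)\ge\pi(k)}l_j\Bigr)d_k-l_k,\qquad k=1,\dots,r.$$ A degree vector $m\in\mathbb{Z}^r_{\ge0}$ gives a Sylvester-type matrix if and only if there exists a permutation $\pi$ of $\{1,\dots,r\}$ such that $m_j\ge m^\pi_j$ for $j=1,\dots,r$. Moreover, the smallest Sylvester-type matrix (over all $m\in\mathbb{Z}^r_{\ge 0}$ giving a Sylvester-type matrix) is attained among the vectors $m^\pi$.
   Context: Let $r\ge 1$ and let $l=(l_1,\dots,l_r)$, $d=(d_1,\dots,d_r)$ be vectors of positive integers; put $n=\sum_{k=1}^r l_k$. Let $X=\mathbb{P}^{l_1}\times\cdots\times\mathbb{P}^{l_r}$ over an algebraically closed field of characteristic zero. For $a\in\mathbb{Z}^r$, $H^q(X,a)$ denotes the $q$-th cohomology of the sheaf $\mathcal{O}_X(a_1,\dots,a_r)$. By the Künneth and Bott formulae, $H^q(X,a)=\bigoplus\bigotimes_{k}H^{j_k}(\mathbb{P}^{l_k},a_k)$ (sum over $j_k\in\{0,l_k\}$ with $\sum_k j_k=q$), where $H^0(\mathbb{P}^{l_k},a_k)\ne0\iff a_k\ge0$ and $H^{l_k}(\mathbb{P}^{l_k},a_k)\neq0\iff a_k<-l_k$. For a degree vector $m\in\mathbb{Z}^r$ and $\nu\in\mathbb{Z}$, the $\nu$-th term of the Weyman complex is $K_\nu(m)=\bigoplus_{p=0}^{n+1}H^{p-\nu}(X,m-pd)^{\binom{n+1}{p}}$.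 A vector $m\in\mathbb{Z}^r_{\ge0}$ is said to give (yield) a Sylvester-type matrix if $K_{-1}(m)=0$, $K_1(m)=H^0(X,m-d)^{n+1}$ and $K_0(m)=H^0(X,m)$, with $H^0(X,m)\ne0$ and $H^0(X,m-d)\neq0$; that is, all other summands in the definitions of $K_{-1}(m),K_0(m),K_1(m)$ vanish. ($K_2(m)$ is not required to be zero or nonzero.) The matrix is that of the map $K_1(m)\to K_0(m)$, $(g_0,\dots,g_n)\mapsto\sum g_if_i$, where $f_0,\dots,f_n$ are multihomogeneous polynomials of degree $d$; its number of rows is $\dim K_0(m)$ and its number of columns is $\dim K_1(m)$. Sizes of Sylvester-type matrices are compared by the number of rows $\dim K_0(m)$. *)

theory Defs
  imports
    "HOL-Library.Poly_Mapping"
    "HOL-Library.FuncSet"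
    "HOL-Library.Function_Algebras"
    "HOL-Computational_Algebra.Polynomial"
    "HOL-Combinatorics.Permutations"
begin

section \<open>Vector spaces presented as subquotients\<close>

text \<open>
  A vector space over \<open>'k\<close> is presented as \<open>numer / denom\<close>, where \<open>denom \<subseteq> numer\<close> are
  subspaces of an ambient abelian group \<open>'v\<close> on which \<open>'k\<close> acts by \<open>scl\<close>.
\<close>

record ('k, 'v) subquot =
  scl :: "'k \<Rightarrow> 'v \<Rightarrow> 'v"
  numer :: "'v set"
  denom :: "'v set"

definition is_zero :: "('k, 'v) subquot \<Rightarrow> bool" where
  "is_zero Q \<longleftrightarrow> numer Q \<subseteq> denom Q"

text \<open>\<open>S\<close> is a set of representatives of a basis of \<open>numer Q / denom Q\<close>.\<close>

definition quot_basis :: "('k::field, 'v::ab_group_add) subquot \<Rightarrow> 'v set \<Rightarrow> bool" where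
  "quot_basis Q S \<longleftrightarrow>
     S \<subseteq> numer Q \<and>
     (\<forall>T c. finite T \<longrightarrow> T \<subseteq> S \<longrightarrow> (\<Sum>v\<in>T. scl Q (c v) v) \<in> denom Q \<longrightarrow> (\<forall>v\<in>T. c v = 0)) \<and>
     (\<forall>z\<in>numer Q. \<exists>T c. finite T \<and> T \<subseteq> S \<and> z - (\<Sum>v\<in>T. scl Q (c v) v) \<in> denom Q)"

text \<open>As for the library's \<open>dim\<close>, the value is \<open>0\<close> if the dimension is infinite; every space
  below whose dimension is used is finite-dimensional.\<close>

definition quot_dim :: "('k::field, 'v::ab_group_add) subquot \<Rightarrow> nat" where
  "quot_dim Q = card (SOME S. quot_basis Q S)"

text \<open>Finite direct sum; all summands are assumed to sit in the same ambient group.\<close>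

definition direct_sum :: "'i set \<Rightarrow> ('i \<Rightarrow> ('k, 'v::zero) subquot) \<Rightarrow> ('k, 'i \<Rightarrow> 'v) subquot" where
  "direct_sum I Q =
     \<lparr> scl = (\<lambda>\<alpha> f i. scl (Q i) \<alpha> (f i)),
       numer = {f. (\<forall>i\<in>I. f i \<in> numer (Q i)) \<and> (\<forall>i. i \<notin> I \<longrightarrow> f i = 0)},
       denom = {f. (\<forall>i\<in>I. f i \<in> denom (Q i)) \<and> (\<forall>i. i \<notin> I \<longrightarrow> f i = 0)} \<rparr>"

definition direct_power :: "nat \<Rightarrow> ('k, 'v::zero) subquot \<Rightarrow> ('k, nat \<Rightarrow> 'v) subquot" where
  "direct_power N Q = direct_sum {..<N} (\<lambda>_. Q)"


section \<open>Cech cohomology of a finite cover\<close>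

text \<open>
  \<open>I\<close> is the index set of the cover and \<open>F S\<close> is the group of sections over the intersection of
  the members of the cover with index in \<open>S\<close>. All these groups are subgroups of one group \<open>'v\<close>
  and \<open>F\<close> is monotone, the restriction maps being the inclusions. A \<open>q\<close>-cochain assigns to each
  \<open>(q+1)\<close>-tuple of indices, represented as a list, a section over the corresponding intersection
  (all cochains, not only the alternating ones); outside these tuples it is \<open>0\<close>.
  The degree is an integer, and there are no nonzero cochains in negative degree.
\<close>

definition cech_tuples :: "'i set \<Rightarrow> int \<Rightarrow> 'i list set" where
  "cech_tuples I q = {xs. xs \<noteq> [] \<and> set xs \<subseteq> I \<and> int (length xs) = q + 1}"

definition cech_cochains :: "'i set \<Rightarrow> ('i set \<Rightarrow> 'v::zero set) \<Rightarrow> int \<Rightarrow> ('i list \<Rightarrow> 'v) set" where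
  "cech_cochains I F q =
     {c. (\<forall>xs\<in>cech_tuples I q. c xs \<in> F (set xs)) \<and> (\<forall>xs. xs \<notin> cech_tuples I q \<longrightarrow> c xs = 0)}"

definition cech_diff :: "'i set \<Rightarrow> ('i list \<Rightarrow> 'v::ring_1) \<Rightarrow> 'i list \<Rightarrow> 'v" where
  "cech_diff I c xs =
     (if set xs \<subseteq> I then \<Sum>j<length xs. (- 1) ^ j * c (take j xs @ drop (Suc j) xs) else 0)"

definition cech_cohomology ::
  "('k \<Rightarrow> 'v \<Rightarrow> 'v) \<Rightarrow> 'i set \<Rightarrow> ('i set \<Rightarrow> 'v::ring_1 set) \<Rightarrow> int \<Rightarrow> ('k, 'i list \<Rightarrow> 'v) subquot" where
  "cech_cohomology s I F q =
     \<lparr> scl = (\<lambda>\<alpha> c xs. s \<alpha> (c xs)),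
       numer = {c \<in> cech_cochains I F q. cech_diff I c = (\<lambda>_. 0)},
       denom = cech_diff I ` cech_cochains I F (q - 1) \<rparr>"


section \<open>Line bundles on a product of projective spaces\<close>

text \<open>
  Laurent polynomials over \<open>'k\<close> in the variables \<open>x\<^sub>(\<^sub>k\<^sub>,\<^sub>i\<^sub>)\<close>; an exponent vector is a finitely
  supported function to the integers. The \<open>k\<close>-th factor \<open>P\<^sup>l\<^sup>k\<close> has the homogeneous coordinates
  \<open>x\<^sub>(\<^sub>k\<^sub>,\<^sub>i\<^sub>)\<close> with \<open>i \<le> l k\<close>, for \<open>k\<close> in \<open>{1..r}\<close>.
\<close>

type_synonym 'k laurent = "((nat \<times> nat) \<Rightarrow>\<^sub>0 int) \<Rightarrow>\<^sub>0 'k"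

definition laurent_scale :: "'k::field \<Rightarrow> 'k laurent \<Rightarrow> 'k laurent" where
  "laurent_scale \<alpha> = Poly_Mapping.map (\<lambda>x. \<alpha> * x)"

text \<open>The standard affine cover of \<open>X\<close> consists of the open sets \<open>U\<^sub>v\<close> on which
  \<open>x\<^sub>(\<^sub>1\<^sub>,\<^sub>v\<^sub>1\<^sub>)\<close>, ..., \<open>x\<^sub>(\<^sub>r\<^sub>,\<^sub>v\<^sub>r\<^sub>)\<close> do not vanish.\<close>

definition std_cover :: "nat \<Rightarrow> (nat \<Rightarrow> nat) \<Rightarrow> (nat \<Rightarrow> nat) set" where
  "std_cover r l = (\<Pi>\<^sub>E k\<in>{1..r}. {..l k})"

text \<open>
  The sections of \<open>O\<^sub>X(a)\<close> over the intersection of the \<open>U\<^sub>v\<close>, \<open>v \<in> S\<close>: the multihomogeneous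
  elements of multidegree \<open>a\<close> of the polynomial ring localised at the variables that are
  invertible there.
\<close>

definition line_bundle_sections ::
  "nat \<Rightarrow> (nat \<Rightarrow> nat) \<Rightarrow> (nat \<Rightarrow> int) \<Rightarrow> (nat \<Rightarrow> nat) set \<Rightarrow> 'k::field laurent set" where
  "line_bundle_sections r l a S =
     {f. \<forall>e\<in>Poly_Mapping.keys f.
           Poly_Mapping.keys e \<subseteq> (SIGMA k:{1..r}. {..l k}) \<and>
           (\<forall>k\<in>{1..r}. (\<Sum>i\<le>l k. Poly_Mapping.lookup e (k, i)) = a k) \<and>
           (\<forall>k i. Poly_Mapping.lookup e (k, i) < 0 \<longrightarrow> (\<exists>v\<in>S. v k = i))}"

text \<open>\<open>H\<^sup>q(X, a)\<close>, computed on the standard affine cover.\<close>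

definition cohom ::
  "nat \<Rightarrow> (nat \<Rightarrow> nat) \<Rightarrow> int \<Rightarrow> (nat \<Rightarrow> int) \<Rightarrow> ('k::field, (nat \<Rightarrow> nat) list \<Rightarrow> 'k laurent) subquot" where
  "cohom r l q a = cech_cohomology laurent_scale (std_cover r l) (line_bundle_sections r l a) q"


section \<open>The Weyman complex and Sylvester-type matrices\<close>

definition dim_X :: "nat \<Rightarrow> (nat \<Rightarrow> nat) \<Rightarrow> nat" where
  "dim_X r l = (\<Sum>k=1..r. l k)"

definition weyman_summand ::
  "nat \<Rightarrow> (nat \<Rightarrow> nat) \<Rightarrow> (nat \<Rightarrow> nat) \<Rightarrow> int \<Rightarrow> (nat \<Rightarrow> int) \<Rightarrow> nat
     \<Rightarrow> ('k::field, nat \<Rightarrow> (nat \<Rightarrow> nat) list \<Rightarrow> 'k laurent) subquot" where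
  "weyman_summand r l d \<nu> m p =
     direct_power (dim_X r l + 1 choose p)
       (cohom r l (int p - \<nu>) (\<lambda>k. m k - int p * int (d k)))"

definition weyman_term ::
  "nat \<Rightarrow> (nat \<Rightarrow> nat) \<Rightarrow> (nat \<Rightarrow> nat) \<Rightarrow> int \<Rightarrow> (nat \<Rightarrow> int)
     \<Rightarrow> ('k::field, nat \<Rightarrow> nat \<Rightarrow> (nat \<Rightarrow> nat) list \<Rightarrow> 'k laurent) subquot" where
  "weyman_term r l d \<nu> m = direct_sum {0..dim_X r l + 1} (weyman_summand r l d \<nu> m)"

text \<open>
  \<open>K\<^sub>1(m) = H\<^sup>0(X, m - d)\<^sup>n\<^sup>+\<^sup>1\<close> and \<open>K\<^sub>0(m) = H\<^sup>0(X, m)\<close> mean that the summands of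
  \<open>K\<^sub>1(m)\<close> with \<open>p \<noteq> 1\<close> and those of \<open>K\<^sub>0(m)\<close> with \<open>p \<noteq> 0\<close> vanish.
\<close>

definition gives_sylvester ::
  "'k::field itself \<Rightarrow> nat \<Rightarrow> (nat \<Rightarrow> nat) \<Rightarrow> (nat \<Rightarrow> nat) \<Rightarrow> (nat \<Rightarrow> int) \<Rightarrow> bool" where
  "gives_sylvester _ r l d m \<longleftrightarrow>
     (\<forall>k\<in>{1..r}. 0 \<le> m k) \<and>
     is_zero (weyman_term r l d (- 1) m :: ('k, _) subquot) \<and>
     (\<forall>p\<in>{0..dim_X r l + 1} - {1}. is_zero (weyman_summand r l d 1 m p :: ('k, _) subquot)) \<and>
     (\<forall>p\<in>{0..dim_X r l + 1} - {0}. is_zero (weyman_summand r l d 0 m p :: ('k, _) subquot)) \<and>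
     \<not> is_zero (cohom r l 0 m :: ('k, _) subquot) \<and>
     \<not> is_zero (cohom r l 0 (\<lambda>k. m k - int (d k)) :: ('k, _) subquot)"

text \<open>The size of the matrix of \<open>K\<^sub>1(m) \<rightarrow> K\<^sub>0(m)\<close>, by which Sylvester-type matrices are compared.\<close>

definition matrix_rows ::
  "'k::field itself \<Rightarrow> nat \<Rightarrow> (nat \<Rightarrow> nat) \<Rightarrow> (nat \<Rightarrow> nat) \<Rightarrow> (nat \<Rightarrow> int) \<Rightarrow> nat" where
  "matrix_rows _ r l d m = quot_dim (weyman_term r l d 0 m :: ('k, _) subquot)"

definition perm_vector ::
  "nat \<Rightarrow> (nat \<Rightarrow> nat) \<Rightarrow> (nat \<Rightarrow> nat) \<Rightarrow> (nat \<Rightarrow> nat) \<Rightarrow> nat \<Rightarrow> int" where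
  "perm_vector r l d \<pi> k =
     (1 + (\<Sum>j\<in>{j\<in>{1..r}. \<pi> j \<ge> \<pi> k}. int (l j))) * int (d k) - int (l k)"

end

theory Submission
  imports Defs
begin

text \<open>
  The Cech complex of a line bundle on \<open>X\<close> splits by exponent vectors. For an exponent \<open>e\<close> with set
  \<open>N\<close> of negative variables it becomes the complex of functions on tuples of vertices of the box
  \<open>\<Prod>\<^sub>k {0..l k}\<close> that are supported on the tuples covering \<open>N\<close>. If in some factor \<open>N\<close> is neither
  empty nor everything, the complex is contractible; otherwise the variables in \<open>N\<close> are removed one
  at a time by a long exact sequence, each removal shifting the degree by one until a single index
  is left in a factor. This gives the Bott and Kuenneth vanishing and nonvanishing.

  For the combinatorial part, \<open>m \<ge> m\<^sup>\<pi>\<close> makes the factors with top cohomology, if there are any,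
  have total dimension at most \<open>p - 2\<close>. Conversely, the permutation is found greedily: if no element
  of the remaining set \<open>U\<close> could be given the next rank, the summand of \<open>K\<^sub>1(m)\<close> with
  \<open>p = 1 + (\<Sum>k\<in>U. l k)\<close> would not vanish. Finally, the number of rows is a number of monomials,
  which is monotone in \<open>m\<close>.
\<close>

section \<open>Cochains supported on covering tuples\<close>

fun face_sum :: "('i list \<Rightarrow> 'v::ab_group_add) \<Rightarrow> 'i list \<Rightarrow> 'v" where
  "face_sum c [] = 0"
| "face_sum c (x # xs) = c xs - face_sum (\<lambda>ys. c (x # ys)) xs"

text \<open>Deleting the first entry gives the leading term; every other face keeps it and picks up
  one more sign. The recursive form lets the identities below go by induction on the tuple with
  \<open>c\<close> arbitrary.\<close>

lemma sum_faces_eq_face_sum: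
  fixes c :: "'i list \<Rightarrow> 'v::ring_1"
  shows "(\<Sum>j<length xs. (- 1) ^ j * c (take j xs @ drop (Suc j) xs)) = face_sum c xs"
proof (induction xs arbitrary: c)
  case (Cons x xs)
  show ?case
    using Cons.IH[of "\<lambda>ys. c (x # ys)"]
    by (simp add: sum.lessThan_Suc_shift sum_negf del: sum.lessThan_Suc)
qed simp

lemma cech_diff_eq: "cech_diff I c xs = (if set xs \<subseteq> I then face_sum c xs else 0)"
  by (simp only: cech_diff_def sum_faces_eq_face_sum)

text \<open>Serves to drop truncations such as \<open>if set ys \<subseteq> I\<close>, because the
  faces of a tuple in \<open>I\<close> stay in \<open>I\<close>.\<close>

lemma face_sum_cong:
  assumes "\<And>ys. set ys \<subseteq> set xs \<Longrightarrow> length xs = Suc (length ys) \<Longrightarrow> f ys = g ys"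
  shows "face_sum f xs = face_sum g xs"
  using assms
proof (induction xs arbitrary: f g)
  case (Cons x xs)
  have "f xs = g xs" by (rule Cons.prems) auto
  moreover have "face_sum (\<lambda>ys. f (x # ys)) xs = face_sum (\<lambda>ys. g (x # ys)) xs"
    by (rule Cons.IH, rule Cons.prems) auto
  ultimately show ?case by simp
qed simp

lemma face_sum_diff: "face_sum (\<lambda>ys. f ys - g ys) xs = face_sum f xs - face_sum g xs"
  by (induction xs arbitrary: f g) simp_all

lemma face_sum_minus: "face_sum (\<lambda>ys. - f ys) xs = - face_sum f xs"
  by (induction xs arbitrary: f) simp_all

lemma face_sum_0: "face_sum (\<lambda>ys. 0) xs = 0"
  by (induction xs) simp_all

lemma face_sum_map: "face_sum (\<lambda>ys. c (map g ys)) xs = face_sum c (map g xs)"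
proof (induction xs arbitrary: c)
  case (Cons x xs)
  show ?case using Cons.IH[of "\<lambda>ys. c (g x # ys)"] by simp
qed simp

text \<open>This is $d^2=0$. With first entry \<open>x\<close> fixed, \<open>face_sum c\<close> is
  \<open>c\<close> minus the face sum of the slice of \<open>c\<close> at \<open>x\<close>; a second
  application cancels both copies of \<open>face_sum c xs\<close> and leaves the induction
  hypothesis for the slice.\<close>

lemma face_sum_face_sum: "face_sum (face_sum c) xs = 0"
proof (induction xs arbitrary: c)
  case (Cons x xs)
  show ?case using Cons.IH[of "\<lambda>ys. c (x # ys)"] by (simp add: face_sum_diff)
qed simp

lemma face_sum_eq_0:
  assumes "\<And>ys. set ys \<subseteq> set xs \<Longrightarrow> length xs = Suc (length ys) \<Longrightarrow> f ys = 0"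
  shows "face_sum f xs = 0"
  using face_sum_cong[of xs f "\<lambda>_. 0"] assms by (simp add: face_sum_0)

lemma face_sum_nonzeroE:
  assumes "face_sum f xs \<noteq> 0"
  obtains ys where "set ys \<subseteq> set xs" "length xs = Suc (length ys)" "f ys \<noteq> 0"
  using assms by (metis face_sum_eq_0)

section \<open>The prism operator of a vertex map\<close>

fun prism :: "('i \<Rightarrow> 'i) \<Rightarrow> ('i list \<Rightarrow> 'v::ab_group_add) \<Rightarrow> 'i list \<Rightarrow> 'v" where
  "prism g c [] = 0"
| "prism g c (x # xs) = c (x # g x # map g xs) - prism g (\<lambda>ys. c (x # ys)) xs"

lemma prism_diff: "prism g (\<lambda>ys. f ys - h ys) xs = prism g f xs - prism g h xs"
  by (induction xs arbitrary: f h) simp_all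

lemma face_sum_prism:
  "face_sum (prism g c) xs + prism g (face_sum c) xs = c (map g xs) - c xs"
proof (induction xs arbitrary: c)
  case (Cons x xs)
  show ?case
    using Cons.IH[of "\<lambda>ys. c (x # ys)"] face_sum_map[of "\<lambda>ys. c (x # g x # ys)" g xs]
    by (simp add: face_sum_diff prism_diff algebra_simps)
qed simp

lemma prism_eq_0:
  assumes "\<And>as x bs. xs = as @ x # bs \<Longrightarrow> c (as @ x # g x # map g bs) = 0"
  shows "prism g c xs = 0"
  using assms
proof (induction xs arbitrary: c)
  case (Cons x xs)
  have "c (x # g x # map g xs) = 0" using Cons.prems[of "[]" x xs] by simp
  moreover have "prism g (\<lambda>ys. c (x # ys)) xs = 0"
  proof (rule Cons.IH)
    fix as y bs assume "xs = as @ y # bs"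
    then show "c (x # as @ y # g y # map g bs) = 0" using Cons.prems[of "x # as" y bs] by simp
  qed
  ultimately show ?case by simp
qed simp

section \<open>Cochains of a single monomial with negative variables \<open>N\<close>\<close>

definition covers :: "('a \<times> 'b) set \<Rightarrow> ('a \<Rightarrow> 'b) set \<Rightarrow> bool" where
  "covers N S \<longleftrightarrow> (\<forall>k i. (k, i) \<in> N \<longrightarrow> (\<exists>v\<in>S. v k = i))"

lemma covers_mono: "covers N S \<Longrightarrow> S \<subseteq> T \<Longrightarrow> covers N T"
  unfolding covers_def by blast

lemma covers_insert: "covers (insert (k, i) N) S \<longleftrightarrow> (\<exists>v\<in>S. v k = i) \<and> covers N S"
  unfolding covers_def by blast

text \<open>These are the possible coefficient functions of one Laurent monomial in a Cech cochain:
  the monomial is regular on an intersection of charts iff each of its negative variables is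
  inverted by one of them. Stating everything as a support condition makes restriction and extension
  by zero easy.\<close>

definition cov_cochains ::
  "('a \<Rightarrow> 'b) set \<Rightarrow> ('a \<times> 'b) set \<Rightarrow> int \<Rightarrow> (('a \<Rightarrow> 'b) list \<Rightarrow> 'v::zero) set" where
  "cov_cochains I N q =
     {c. \<forall>xs. c xs \<noteq> 0 \<longrightarrow> xs \<noteq> [] \<and> set xs \<subseteq> I \<and> int (length xs) = q + 1 \<and> covers N (set xs)}"

text \<open>Vanishing of cohomology in degree \<open>q\<close>. Face sums are tested only on tuples
  in \<open>I\<close>, as \<open>cech_diff\<close> is set to zero on all others.\<close>

definition cov_exact :: "'v::ab_group_add itself \<Rightarrow> ('a \<Rightarrow> 'b) set \<Rightarrow> ('a \<times> 'b) set \<Rightarrow> int \<Rightarrow> bool" where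
  "cov_exact _ I N q \<longleftrightarrow>
     (\<forall>c :: ('a \<Rightarrow> 'b) list \<Rightarrow> 'v. c \<in> cov_cochains I N q \<longrightarrow>
        (\<forall>xs. set xs \<subseteq> I \<longrightarrow> face_sum c xs = 0) \<longrightarrow>
        (\<exists>b\<in>cov_cochains I N (q - 1). \<forall>xs. set xs \<subseteq> I \<longrightarrow> face_sum b xs = c xs))"

lemma cov_cochainsI:
  assumes "\<And>xs. c xs \<noteq> 0 \<Longrightarrow> xs \<noteq> [] \<and> set xs \<subseteq> I \<and> int (length xs) = q + 1 \<and> covers N (set xs)"
  shows "c \<in> cov_cochains I N q"
  using assms unfolding cov_cochains_def by blast

lemma cov_cochainsD:
  assumes "c \<in> cov_cochains I N q" "c xs \<noteq> 0"
  shows "xs \<noteq> []" "set xs \<subseteq> I" "int (length xs) = q + 1" "covers N (set xs)"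
  using assms unfolding cov_cochains_def by blast+

lemma cov_cochains_diff:
  fixes b c :: "('a \<Rightarrow> 'b) list \<Rightarrow> 'v::ab_group_add"
  assumes "b \<in> cov_cochains I N q" "c \<in> cov_cochains I N q"
  shows "(\<lambda>xs. b xs - c xs) \<in> cov_cochains I N q"
proof (rule cov_cochainsI)
  fix xs assume "b xs - c xs \<noteq> 0"
  then have "b xs \<noteq> 0 \<or> c xs \<noteq> 0" by auto
  then show "xs \<noteq> [] \<and> set xs \<subseteq> I \<and> int (length xs) = q + 1 \<and> covers N (set xs)"
    using cov_cochainsD[OF assms(1)] cov_cochainsD[OF assms(2)] by metis
qed

text \<open>Resetting one coordinate to a value that need not be covered is homotopic to the identity
  through cochains, and it destroys the covering of that coordinate.\<close>

lemma cov_exact_acyclic: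
  assumes k: "k \<in> K" "w \<in> W k" "(k, w) \<notin> N" "(k, i) \<in> N"
  shows "cov_exact TYPE('v::ab_group_add) (PiE K W) N q"
  unfolding cov_exact_def
proof (intro allI impI)
  let ?I = "PiE K W"
  fix c :: "('a \<Rightarrow> 'b) list \<Rightarrow> 'v"
  assume c: "c \<in> cov_cochains ?I N q" and cocycle: "\<forall>xs. set xs \<subseteq> ?I \<longrightarrow> face_sum c xs = 0"
  define g :: "('a \<Rightarrow> 'b) \<Rightarrow> 'a \<Rightarrow> 'b" where "g v = v(k := w)" for v
  have gI: "g v \<in> ?I" if "v \<in> ?I" for v
    using that k unfolding g_def by (auto simp: PiE_iff extensional_def)
  have iw: "i \<noteq> w" using k by auto
  \<comment> \<open>After the reset no vertex has \<open>k\<close>-th coordinate \<open>i\<close>,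
    so the requirement \<open>(k, i)\<close> is never met and the pullback of \<open>c\<close> along
    \<open>g\<close> vanishes.\<close>
  have cg: "c (map g xs) = 0" for xs
  proof (rule ccontr)
    assume "c (map g xs) \<noteq> 0"
    then have "covers N (set (map g xs))" by (rule cov_cochainsD[OF c])
    then obtain v where "v \<in> set xs" "g v k = i" using k(4) unfolding covers_def by auto
    then show False using iw by (simp add: g_def)
  qed
  \<comment> \<open>For a cocycle with zero pullback the homotopy formula reads $d(hc)=-c$, hence
    the sign.\<close>
  define b where "b = (\<lambda>xs. if set xs \<subseteq> ?I then - prism g c xs else 0)"
  have "b \<in> cov_cochains ?I N (q - 1)"
  proof (rule cov_cochainsI)
    fix xs assume bxs: "b xs \<noteq> 0"
    then have "prism g c xs \<noteq> 0" and sub: "set xs \<subseteq> ?I" by (auto simp: b_def split: if_splits)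
    then obtain as x bs where xs: "xs = as @ x # bs" and nz: "c (as @ x # g x # map g bs) \<noteq> 0"
      using prism_eq_0 by blast
    note D = cov_cochainsD[OF c nz]
    have "covers N (set xs)"
      unfolding covers_def
    proof (intro allI impI)
      fix k' i' assume N: "(k', i') \<in> N"
      then obtain v where v: "v \<in> set (as @ x # g x # map g bs)" "v k' = i'"
        using D(4) unfolding covers_def by blast
      consider "v \<in> set xs" | y where "y \<in> set xs" "v = g y"
        using v(1) by (auto simp: xs)
      then show "\<exists>v\<in>set xs. v k' = i'"
      proof cases
        case 1
        then show ?thesis using v by blast
      next
        case 2
        have "k' \<noteq> k" using N k(3) v(2) 2 by (auto simp: g_def)
        then show ?thesis using 2 v(2) by (auto simp: g_def)
      qed
    qed
    with sub D(3) xs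
    show "xs \<noteq> [] \<and> set xs \<subseteq> ?I \<and> int (length xs) = q - 1 + 1 \<and> covers N (set xs)"
      by simp
  qed
  moreover have "face_sum b xs = c xs" if xs: "set xs \<subseteq> ?I" for xs
  proof -
    have "face_sum b xs = face_sum (\<lambda>ys. - prism g c ys) xs"
      using xs by (intro face_sum_cong) (auto simp: b_def)
    moreover have "prism g (face_sum c) xs = 0"
    proof (rule prism_eq_0)
      fix as x bs assume "xs = as @ x # bs"
      then have "set (as @ x # g x # map g bs) \<subseteq> ?I" using xs by (auto simp del: PiE_iff intro!: gI)
      then show "face_sum c (as @ x # g x # map g bs) = 0" using cocycle by blast
    qed
    ultimately show ?thesis using face_sum_prism[of g c xs] cg by (simp add: face_sum_minus)
  qed
  ultimately show "\<exists>b\<in>cov_cochains ?I N (q - 1). \<forall>xs. set xs \<subseteq> ?I \<longrightarrow> face_sum b xs = c xs"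
    by blast
qed

text \<open>The long exact sequence of the cochains covering \<open>N\<close> but not \<open>(k, i)\<close>.\<close>

lemma cov_exact_delete:
  fixes I :: "('a \<Rightarrow> 'b) set"
  assumes acyclic: "\<And>q. cov_exact TYPE('v::ab_group_add) I N q"
  shows "cov_exact TYPE('v) I (insert (k, i) N) q \<longleftrightarrow>
         cov_exact TYPE('v) {v \<in> I. v k \<noteq> i} N (q - 1)"
proof
  let ?I' = "{v \<in> I. v k \<noteq> i}" and ?N = "insert (k, i) N"
  assume ex: "cov_exact TYPE('v) I ?N q"
  show "cov_exact TYPE('v) ?I' N (q - 1)"
    unfolding cov_exact_def
  proof (intro allI impI)
    fix u :: "('a \<Rightarrow> 'b) list \<Rightarrow> 'v"
    assume u: "u \<in> cov_cochains ?I' N (q - 1)"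
      and cocycle: "\<forall>xs. set xs \<subseteq> ?I' \<longrightarrow> face_sum u xs = 0"
    \<comment> \<open>The connecting homomorphism: \<open>u\<close> is extended by zero to
      \<open>I\<close>. Its face sum vanishes on tuples avoiding \<open>i\<close>, so it is
      supported on tuples that cover \<open>(k, i)\<close>.\<close>
    define c where "c = (\<lambda>xs. if set xs \<subseteq> I then face_sum u xs else 0)"
    have c: "c \<in> cov_cochains I ?N q"
    proof (rule cov_cochainsI)
      fix xs assume nz: "c xs \<noteq> 0"
      then have sub: "set xs \<subseteq> I" and nz': "face_sum u xs \<noteq> 0"
        by (auto simp: c_def split: if_splits)
      from nz' obtain ys where ys: "set ys \<subseteq> set xs" "length xs = Suc (length ys)" "u ys \<noteq> 0"
        by (rule face_sum_nonzeroE)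
      note D = cov_cochainsD[OF u ys(3)]
      have "\<not> set xs \<subseteq> ?I'" using nz' cocycle by blast
      then have "\<exists>v\<in>set xs. v k = i" using sub by blast
      then show "xs \<noteq> [] \<and> set xs \<subseteq> I \<and> int (length xs) = q + 1 \<and> covers ?N (set xs)"
        using sub ys D covers_mono[OF D(4) ys(1)] by (auto simp: covers_insert)
    qed
    have "face_sum c xs = 0" if "set xs \<subseteq> I" for xs
    proof -
      have "face_sum c xs = face_sum (face_sum u) xs"
        using that by (intro face_sum_cong) (auto simp: c_def)
      then show ?thesis by (simp add: face_sum_face_sum)
    qed
    then obtain b where b: "b \<in> cov_cochains I ?N (q - 1)"
        and bc: "\<And>xs. set xs \<subseteq> I \<Longrightarrow> face_sum b xs = c xs"
      using ex c unfolding cov_exact_def by blast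
    \<comment> \<open>Both \<open>u\<close> and \<open>b\<close> have the boundary \<open>c\<close>,
      so their difference is a cocycle of the acyclic complex.\<close>
    define z where "z = (\<lambda>xs. u xs - b xs)"
    have z: "z \<in> cov_cochains I N (q - 1)"
      unfolding z_def
    proof (rule cov_cochains_diff)
      show "u \<in> cov_cochains I N (q - 1)"
        using u unfolding cov_cochains_def by blast
      show "b \<in> cov_cochains I N (q - 1)"
        using b unfolding cov_cochains_def by (auto simp: covers_insert)
    qed
    have "face_sum z xs = 0" if "set xs \<subseteq> I" for xs
      using that bc[OF that] by (simp add: z_def face_sum_diff c_def)
    then obtain w where w: "w \<in> cov_cochains I N (q - 1 - 1)"
        and wz: "\<And>xs. set xs \<subseteq> I \<Longrightarrow> face_sum w xs = z xs"
      using acyclic[of "q - 1"] z unfolding cov_exact_def by blast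
    \<comment> \<open>On tuples avoiding \<open>i\<close> the cochain \<open>b\<close> is zero, so
      there the primitive \<open>w\<close> of \<open>u - b\<close> is a primitive of
      \<open>u\<close>.\<close>
    define w' where "w' = (\<lambda>xs. if set xs \<subseteq> ?I' then w xs else 0)"
    have "w' \<in> cov_cochains ?I' N (q - 1 - 1)"
    proof (rule cov_cochainsI)
      fix xs assume "w' xs \<noteq> 0"
      then have "w xs \<noteq> 0" "set xs \<subseteq> ?I'" by (auto simp: w'_def split: if_splits)
      then show "xs \<noteq> [] \<and> set xs \<subseteq> ?I' \<and> int (length xs) = q - 1 - 1 + 1 \<and> covers N (set xs)"
        using cov_cochainsD[OF w] by metis
    qed
    moreover have "face_sum w' xs = u xs" if xs: "set xs \<subseteq> ?I'" for xs
    proof -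
      have "face_sum w' xs = face_sum w xs"
        using xs by (intro face_sum_cong) (auto simp: w'_def)
      also have "\<dots> = u xs - b xs" using wz xs by (auto simp: z_def)
      also have "b xs = 0"
        using cov_cochainsD(4)[OF b, of xs] xs by (auto simp: covers_insert)
      finally show ?thesis by simp
    qed
    ultimately show "\<exists>b\<in>cov_cochains ?I' N (q - 1 - 1). \<forall>xs. set xs \<subseteq> ?I' \<longrightarrow> face_sum b xs = u xs"
      by blast
  qed
next
  let ?I' = "{v \<in> I. v k \<noteq> i}" and ?N = "insert (k, i) N"
  assume ex: "cov_exact TYPE('v) ?I' N (q - 1)"
  show "cov_exact TYPE('v) I ?N q"
    unfolding cov_exact_def
  proof (intro allI impI)
    fix c :: "('a \<Rightarrow> 'b) list \<Rightarrow> 'v"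
    assume c: "c \<in> cov_cochains I ?N q" and cocycle: "\<forall>xs. set xs \<subseteq> I \<longrightarrow> face_sum c xs = 0"
    have "c \<in> cov_cochains I N q"
      using c unfolding cov_cochains_def by (auto simp: covers_insert)
    then obtain b where b: "b \<in> cov_cochains I N (q - 1)"
        and bc: "\<And>xs. set xs \<subseteq> I \<Longrightarrow> face_sum b xs = c xs"
      using acyclic[of q] cocycle unfolding cov_exact_def by blast
    \<comment> \<open>The primitive \<open>b\<close> need not vanish on tuples avoiding
      \<open>i\<close>. Its restriction to them is a cocycle because \<open>c\<close> is zero
      there.\<close>
    define b' where "b' = (\<lambda>xs. if set xs \<subseteq> ?I' then b xs else 0)"
    have b': "b' \<in> cov_cochains ?I' N (q - 1)"
    proof (rule cov_cochainsI)
      fix xs assume "b' xs \<noteq> 0"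
      then have "b xs \<noteq> 0" "set xs \<subseteq> ?I'" by (auto simp: b'_def split: if_splits)
      then show "xs \<noteq> [] \<and> set xs \<subseteq> ?I' \<and> int (length xs) = q - 1 + 1 \<and> covers N (set xs)"
        using cov_cochainsD[OF b] by metis
    qed
    have "face_sum b' xs = 0" if xs: "set xs \<subseteq> ?I'" for xs
    proof -
      have "face_sum b' xs = face_sum b xs"
        using xs by (intro face_sum_cong) (auto simp: b'_def)
      also have "\<dots> = c xs" using bc xs by auto
      also have "c xs = 0"
        using cov_cochainsD(4)[OF c, of xs] xs by (auto simp: covers_insert)
      finally show ?thesis .
    qed
    then obtain u where u: "u \<in> cov_cochains ?I' N (q - 1 - 1)"
        and ub: "\<And>xs. set xs \<subseteq> ?I' \<Longrightarrow> face_sum u xs = b' xs"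
      using ex b' unfolding cov_exact_def by blast
    \<comment> \<open>Subtracting a coboundary leaves the face sum unchanged and makes the primitive
      vanish on tuples avoiding \<open>i\<close>.\<close>
    define a where "a = (\<lambda>xs. if set xs \<subseteq> I then b xs - face_sum u xs else 0)"
    have "a \<in> cov_cochains I ?N (q - 1)"
    proof (rule cov_cochainsI)
      fix xs assume nz: "a xs \<noteq> 0"
      then have sub: "set xs \<subseteq> I" and nz': "b xs \<noteq> face_sum u xs"
        by (auto simp: a_def split: if_splits)
      have "\<not> set xs \<subseteq> ?I'" using nz' ub[of xs] by (auto simp: b'_def)
      then have hit: "\<exists>v\<in>set xs. v k = i" using sub by blast
      have "xs \<noteq> [] \<and> int (length xs) = q - 1 + 1 \<and> covers N (set xs)"
      proof (cases "b xs = 0")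
        case False
        then show ?thesis using cov_cochainsD[OF b] by metis
      next
        case True
        then have "face_sum u xs \<noteq> 0" using nz' by simp
        then obtain ys where ys: "set ys \<subseteq> set xs" "length xs = Suc (length ys)" "u ys \<noteq> 0"
          by (rule face_sum_nonzeroE)
        note D = cov_cochainsD[OF u ys(3)]
        show ?thesis using ys D covers_mono[OF D(4) ys(1)] by auto
      qed
      then show "xs \<noteq> [] \<and> set xs \<subseteq> I \<and> int (length xs) = q - 1 + 1 \<and> covers ?N (set xs)"
        using sub hit by (simp add: covers_insert)
    qed
    moreover have "face_sum a xs = c xs" if xs: "set xs \<subseteq> I" for xs
    proof -
      have "face_sum a xs = face_sum (\<lambda>ys. b ys - face_sum u ys) xs"
        using xs by (intro face_sum_cong) (auto simp: a_def)
      then show ?thesis using bc[OF xs] by (simp add: face_sum_diff face_sum_face_sum)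
    qed
    ultimately show "\<exists>b\<in>cov_cochains I ?N (q - 1). \<forall>xs. set xs \<subseteq> I \<longrightarrow> face_sum b xs = c xs"
      by blast
  qed
qed

text \<open>The covering condition is void here, so this is the unaugmented cochain complex of a
  full simplex: only the constants in degree 0 survive.\<close>

lemma cov_exact_simplex:
  fixes I :: "('a \<Rightarrow> 'b) set"
  assumes "I \<noteq> {}" and cov: "\<And>v. v \<in> I \<Longrightarrow> covers N {v}"
  shows "cov_exact TYPE('v::ring_1) I N q \<longleftrightarrow> q \<noteq> 0"
proof
  obtain v0 where v0: "v0 \<in> I" using assms by blast
  assume ex: "cov_exact TYPE('v) I N q"
  show "q \<noteq> 0"
  proof
    assume q: "q = 0"
    \<comment> \<open>The constant 0-cochain is a cocycle. It is no coboundary, because cochains are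
      zero on the empty tuple.\<close>
    define c :: "('a \<Rightarrow> 'b) list \<Rightarrow> 'v" where "c = (\<lambda>xs. if set xs \<subseteq> I \<and> length xs = 1 then 1 else 0)"
    have "c \<in> cov_cochains I N q"
    proof (rule cov_cochainsI)
      fix xs assume "c xs \<noteq> 0"
      then have "set xs \<subseteq> I" "length xs = 1" by (auto simp: c_def split: if_splits)
      then show "xs \<noteq> [] \<and> set xs \<subseteq> I \<and> int (length xs) = q + 1 \<and> covers N (set xs)"
        using q cov by (auto simp: length_Suc_conv)
    qed
    moreover have "face_sum c xs = 0" if "set xs \<subseteq> I" for xs
    proof (cases "length xs = 2")
      case True
      then obtain x y where "xs = [x, y]" by (auto simp: length_Suc_conv numeral_2_eq_2)
      then show ?thesis using that by (simp add: c_def)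
    next
      case False
      then show ?thesis by (intro face_sum_eq_0) (auto simp: c_def)
    qed
    ultimately obtain b where b: "b \<in> cov_cochains I N (q - 1)"
        and bc: "\<And>xs. set xs \<subseteq> I \<Longrightarrow> face_sum b xs = c xs"
      using ex unfolding cov_exact_def by blast
    have "b [] = 0" using cov_cochainsD(1)[OF b] by blast
    moreover have "face_sum b [v0] = 1" using bc[of "[v0]"] v0 by (simp add: c_def)
    ultimately show False by simp
  qed
next
  obtain v0 where v0: "v0 \<in> I" using assms by blast
  assume q: "q \<noteq> 0"
  show "cov_exact TYPE('v) I N q"
    unfolding cov_exact_def
  proof (intro allI impI)
    fix c :: "('a \<Rightarrow> 'b) list \<Rightarrow> 'v"
    assume c: "c \<in> cov_cochains I N q" and cocycle: "\<forall>xs. set xs \<subseteq> I \<longrightarrow> face_sum c xs = 0"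
    \<comment> \<open>The cone with apex \<open>v0\<close>. The condition
      \<open>q \<noteq> 0\<close> excludes the empty tuple from the support.\<close>
    define b where "b = (\<lambda>xs. c (v0 # xs))"
    have "b \<in> cov_cochains I N (q - 1)"
    proof (rule cov_cochainsI)
      fix xs assume "b xs \<noteq> 0"
      then have D: "set (v0 # xs) \<subseteq> I" "int (length (v0 # xs)) = q + 1"
        using cov_cochainsD[OF c] unfolding b_def by metis+
      then have ne: "xs \<noteq> []" using q by auto
      then have "covers N {hd xs}" using cov D by (auto intro: hd_in_set)
      then have "covers N (set xs)" by (rule covers_mono) (use ne in auto)
      then show "xs \<noteq> [] \<and> set xs \<subseteq> I \<and> int (length xs) = q - 1 + 1 \<and> covers N (set xs)"
        using D ne by simp
    qed
    moreover have "face_sum b xs = c xs" if "set xs \<subseteq> I" for xs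
      using cocycle[rule_format, of "v0 # xs"] that v0 by (simp add: b_def)
    ultimately show "\<exists>b\<in>cov_cochains I N (q - 1). \<forall>xs. set xs \<subseteq> I \<longrightarrow> face_sum b xs = c xs"
      by blast
  qed
qed

text \<open>Induction on the number of required pairs. Removing an index from a factor in
  \<open>J\<close> shrinks that factor and lowers the degree by one. Once every factor in
  \<open>J\<close> has a single index left, each vertex covers everything and the simplex lemma
  applies.\<close>

lemma cov_exact_box:
  fixes W :: "'a \<Rightarrow> 'b set"
  assumes K: "finite K" and J: "J \<subseteq> K" and W: "\<And>k. k \<in> K \<Longrightarrow> finite (W k) \<and> W k \<noteq> {}"
  shows "cov_exact TYPE('v::ring_1) (PiE K W) (Sigma J W) q \<longleftrightarrow> q \<noteq> (\<Sum>k\<in>J. int (card (W k)) - 1)"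
  using W
proof (induction "\<Sum>k\<in>J. card (W k)" arbitrary: W q rule: less_induct)
  case less
  have finJ: "finite J" using K J finite_subset by blast
  show ?case
  proof (cases "\<forall>k\<in>J. card (W k) = 1")
    case True
    have "PiE K W \<noteq> {}" using less.prems by (simp add: PiE_eq_empty_iff)
    moreover have "covers (Sigma J W) {v}" if v: "v \<in> PiE K W" for v
    proof -
      have "v k = i" if "k \<in> J" "i \<in> W k" for k i
      proof -
        have "v k \<in> W k" using v J that by auto
        then show ?thesis using True that by (auto simp: card_1_singleton_iff)
      qed
      then show ?thesis by (auto simp: covers_def)
    qed
    ultimately show ?thesis using True by (simp add: cov_exact_simplex)
  next
    case False
    then obtain k where k: "k \<in> J" "card (W k) \<noteq> 1" by blast
    have Wk: "finite (W k)" "W k \<noteq> {}" using less.prems k J by auto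
    then obtain i where i: "i \<in> W k" by blast
    have "W k - {i} \<noteq> {}"
    proof
      assume "W k - {i} = {}"
      then have "W k = {i}" using i by blast
      then show False using k by simp
    qed
    \<comment> \<open>A second index \<open>j\<close> keeps a requirement in factor \<open>k\<close>
      after \<open>(k, i)\<close> is dropped, so that \<open>cov_exact_acyclic\<close> applies with
      \<open>i\<close> as the value left uncovered.\<close>
    then obtain j where j: "j \<in> W k" "j \<noteq> i" by blast
    define W' where "W' = W(k := W k - {i})"
    have card': "card (W k) = Suc (card (W' k))"
      using card_Suc_Diff1[OF Wk(1) i] by (simp add: W'_def)
    \<comment> \<open>Needed with two functions \<open>f\<close>: the identity on \<open>nat\<close>
      for the induction measure, and the integer \<open>int n - 1\<close> for the degree.\<close>
    have sum': "(\<Sum>k\<in>J. f (card (W k))) = f (card (W k)) + (\<Sum>k\<in>J - {k}. f (card (W' k)))"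
      for f :: "nat \<Rightarrow> 'n::comm_monoid_add"
      using finJ k by (subst sum.remove[of J k]) (auto simp: W'_def intro!: sum.cong)
    have sum'': "(\<Sum>k\<in>J. f (card (W' k))) = f (card (W' k)) + (\<Sum>k\<in>J - {k}. f (card (W' k)))"
      for f :: "nat \<Rightarrow> 'n::comm_monoid_add"
      using finJ k by (subst sum.remove[of J k]) auto
    have Sig: "Sigma J W = insert (k, i) (Sigma J W')"
      using i k by (auto simp: W'_def split: if_splits)
    have box: "{v \<in> PiE K W. v k \<noteq> i} = PiE K W'"
      using k J by (auto simp: W'_def PiE_iff extensional_def split: if_splits)
    have "cov_exact TYPE('v) (PiE K W) (Sigma J W') q'" for q'
    proof (rule cov_exact_acyclic)
      show "k \<in> K" "i \<in> W k" using k J i by auto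
      show "(k, i) \<notin> Sigma J W'" "(k, j) \<in> Sigma J W'" using k j by (auto simp: W'_def)
    qed
    then have "cov_exact TYPE('v) (PiE K W) (Sigma J W) q \<longleftrightarrow>
        cov_exact TYPE('v) (PiE K W') (Sigma J W') (q - 1)"
      unfolding Sig box[symmetric] by (rule cov_exact_delete)
    also have "\<dots> \<longleftrightarrow> q - 1 \<noteq> (\<Sum>k\<in>J. int (card (W' k)) - 1)"
    proof (rule less.hyps)
      show "(\<Sum>k\<in>J. card (W' k)) < (\<Sum>k\<in>J. card (W k))"
        using sum'[of "\<lambda>n. n"] sum''[of "\<lambda>n. n"] card' by simp
      show "finite (W' k') \<and> W' k' \<noteq> {}" if "k' \<in> K" for k'
        using less.prems[OF that] j Wk by (auto simp: W'_def)
    qed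
    also have "\<dots> \<longleftrightarrow> q \<noteq> (\<Sum>k\<in>J. int (card (W k)) - 1)"
      using sum'[of "\<lambda>n. int n - 1"] sum''[of "\<lambda>n. int n - 1"] card' by auto
    finally show ?thesis .
  qed
qed

section \<open>Cohomology of line bundles\<close>

text \<open>The assumption allows an element of one summand to be extended by zero to the others;
  the record alone does not put \<open>0\<close> into \<open>numer\<close>.\<close>

lemma is_zero_direct_sum:
  assumes "\<And>i. i \<in> I \<Longrightarrow> 0 \<in> numer (Q i)"
  shows "is_zero (direct_sum I Q) \<longleftrightarrow> (\<forall>i\<in>I. is_zero (Q i))"
proof
  assume z: "is_zero (direct_sum I Q)"
  show "\<forall>i\<in>I. is_zero (Q i)"
    unfolding is_zero_def
  proof (intro ballI subsetI)
    fix i x assume i: "i \<in> I" and x: "x \<in> numer (Q i)"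
    have "(\<lambda>j. if j = i then x else 0) \<in> numer (direct_sum I Q)"
      using assms i x by (auto simp: direct_sum_def)
    then have "(\<lambda>j. if j = i then x else 0) \<in> denom (direct_sum I Q)"
      using z unfolding is_zero_def by blast
    then show "x \<in> denom (Q i)" using i by (force simp: direct_sum_def)
  qed
next
  assume "\<forall>i\<in>I. is_zero (Q i)"
  then show "is_zero (direct_sum I Q)"
    by (auto simp: direct_sum_def is_zero_def)
qed

section \<open>Splitting the Cech complex by exponent vectors\<close>

definition neg_vars :: "((nat \<times> nat) \<Rightarrow>\<^sub>0 int) \<Rightarrow> (nat \<times> nat) set" where
  "neg_vars e = {x. Poly_Mapping.lookup e x < 0}"

definition exponents :: "nat \<Rightarrow> (nat \<Rightarrow> nat) \<Rightarrow> (nat \<Rightarrow> int) \<Rightarrow> ((nat \<times> nat) \<Rightarrow>\<^sub>0 int) set" where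
  "exponents r l a =
     {e. Poly_Mapping.keys e \<subseteq> (SIGMA k:{1..r}. {..l k}) \<and>
         (\<forall>k\<in>{1..r}. (\<Sum>i\<le>l k. Poly_Mapping.lookup e (k, i)) = a k)}"

lemma mem_line_bundle_sections_iff:
  "f \<in> line_bundle_sections r l a S \<longleftrightarrow>
     (\<forall>e. Poly_Mapping.lookup f e \<noteq> 0 \<longrightarrow> e \<in> exponents r l a \<and> covers (neg_vars e) S)"
  unfolding line_bundle_sections_def exponents_def covers_def neg_vars_def
  by (auto simp: in_keys_iff)

lemma line_bundle_sections_0: "0 \<in> line_bundle_sections r l a S"
  by (simp add: mem_line_bundle_sections_iff)

lemma mem_cech_cochains_iff:
  "c \<in> cech_cochains I (line_bundle_sections r l a) q \<longleftrightarrow>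
     (\<forall>e. (\<lambda>xs. Poly_Mapping.lookup (c xs) e) \<in> cov_cochains I (neg_vars e) q) \<and>
     (\<forall>e xs. e \<notin> exponents r l a \<longrightarrow> Poly_Mapping.lookup (c xs) e = 0)"
  (is "?L \<longleftrightarrow> ?R")
proof
  assume L: ?L
  have *: "xs \<in> cech_tuples I q \<and> e \<in> exponents r l a \<and> covers (neg_vars e) (set xs)"
    if "Poly_Mapping.lookup (c xs) e \<noteq> 0" for xs e
  proof -
    have "c xs \<noteq> 0" using that by auto
    then have xs: "xs \<in> cech_tuples I q" using L unfolding cech_cochains_def by blast
    then have "c xs \<in> line_bundle_sections r l a (set xs)"
      using L unfolding cech_cochains_def by blast
    then show ?thesis using xs that by (simp add: mem_line_bundle_sections_iff)
  qed
  then show ?R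
    unfolding cov_cochains_def cech_tuples_def by blast
next
  assume R: ?R
  have *: "xs \<in> cech_tuples I q \<and> e \<in> exponents r l a \<and> covers (neg_vars e) (set xs)"
    if "Poly_Mapping.lookup (c xs) e \<noteq> 0" for xs e
    using that R unfolding cov_cochains_def cech_tuples_def by blast
  show ?L
    unfolding cech_cochains_def mem_Collect_eq
  proof (intro conjI ballI allI impI)
    show "c xs \<in> line_bundle_sections r l a (set xs)" for xs
      using * by (simp add: mem_line_bundle_sections_iff)
    show "c xs = 0" if "xs \<notin> cech_tuples I q" for xs
      using * that by (intro poly_mapping_eqI) auto
  qed
qed

lemma lookup_face_sum:
  "Poly_Mapping.lookup (face_sum c xs) e = face_sum (\<lambda>ys. Poly_Mapping.lookup (c ys) e) xs"
  by (induction xs arbitrary: c) (simp_all add: lookup_minus)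

lemma cech_diff_eq_0_iff:
  "cech_diff I c = (\<lambda>_. 0) \<longleftrightarrow> (\<forall>xs. set xs \<subseteq> I \<longrightarrow> face_sum c xs = 0)"
  by (auto simp: fun_eq_iff cech_diff_eq)

text \<open>The differential only adds and subtracts sections, so it acts on the coefficient of each
  monomial separately.\<close>

lemma is_zero_cohom_iff:
  "is_zero (cohom r l q a :: ('k::field, _) subquot) \<longleftrightarrow>
     (\<forall>e\<in>exponents r l a. cov_exact TYPE('k) (std_cover r l) (neg_vars e) q)"
proof
  let ?I = "std_cover r l" and ?F = "line_bundle_sections r l a :: _ \<Rightarrow> 'k laurent set"
  assume z: "is_zero (cohom r l q a :: ('k, _) subquot)"
  show "\<forall>e\<in>exponents r l a. cov_exact TYPE('k) ?I (neg_vars e) q"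
    unfolding cov_exact_def
  proof (intro ballI allI impI)
    fix e and z :: "(nat \<Rightarrow> nat) list \<Rightarrow> 'k"
    assume e: "e \<in> exponents r l a" and zc: "z \<in> cov_cochains ?I (neg_vars e) q"
      and cocycle: "\<forall>xs. set xs \<subseteq> ?I \<longrightarrow> face_sum z xs = 0"
    \<comment> \<open>A scalar cochain is placed on the single monomial \<open>e\<close>; the
      coefficient of \<open>e\<close> in a primitive is then the primitive sought.\<close>
    define c where "c = (\<lambda>xs. Poly_Mapping.single e (z xs))"
    have lc: "(\<lambda>xs. Poly_Mapping.lookup (c xs) e') = (if e' = e then z else (\<lambda>_. 0))" for e'
      by (auto simp: c_def lookup_single fun_eq_iff when_def)
    have "c \<in> cech_cochains ?I ?F q"
      unfolding mem_cech_cochains_iff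
    proof (intro conjI allI impI)
      show "(\<lambda>xs. Poly_Mapping.lookup (c xs) e') \<in> cov_cochains ?I (neg_vars e') q" for e'
        using zc by (auto simp: lc) (simp add: cov_cochains_def)
      show "Poly_Mapping.lookup (c xs) e' = 0" if "e' \<notin> exponents r l a" for e' xs
        using that e by (auto simp: c_def lookup_single when_def)
    qed
    moreover have "cech_diff ?I c = (\<lambda>_. 0)"
      unfolding cech_diff_eq_0_iff
    proof (intro allI impI poly_mapping_eqI)
      fix xs e' assume "set xs \<subseteq> ?I"
      then show "Poly_Mapping.lookup (face_sum c xs) e' = Poly_Mapping.lookup 0 e'"
        using cocycle by (simp add: lookup_face_sum lc face_sum_0)
    qed
    ultimately have "c \<in> cech_diff ?I ` cech_cochains ?I ?F (q - 1)"
      using z unfolding is_zero_def cohom_def cech_cohomology_def by auto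
    then obtain b where b: "b \<in> cech_cochains ?I ?F (q - 1)" and bc: "c = cech_diff ?I b"
      by blast
    have "face_sum (\<lambda>ys. Poly_Mapping.lookup (b ys) e) xs = z xs" if "set xs \<subseteq> ?I" for xs
    proof -
      have "Poly_Mapping.lookup (c xs) e = Poly_Mapping.lookup (face_sum b xs) e"
        using that by (simp add: bc cech_diff_eq)
      then show ?thesis by (simp add: lookup_face_sum c_def)
    qed
    moreover have "(\<lambda>ys. Poly_Mapping.lookup (b ys) e) \<in> cov_cochains ?I (neg_vars e) (q - 1)"
      using b by (simp add: mem_cech_cochains_iff)
    ultimately show "\<exists>b\<in>cov_cochains ?I (neg_vars e) (q - 1).
        \<forall>xs. set xs \<subseteq> ?I \<longrightarrow> face_sum b xs = z xs"
      by blast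
  qed
next
  let ?I = "std_cover r l" and ?F = "line_bundle_sections r l a :: _ \<Rightarrow> 'k laurent set"
  assume ex: "\<forall>e\<in>exponents r l a. cov_exact TYPE('k) ?I (neg_vars e) q"
  have "c \<in> cech_diff ?I ` cech_cochains ?I ?F (q - 1)"
    if c: "c \<in> cech_cochains ?I ?F q" and cocycle: "cech_diff ?I c = (\<lambda>_. 0)"
    for c :: "(nat \<Rightarrow> nat) list \<Rightarrow> 'k laurent"
  proof -
    have "\<exists>b\<in>cov_cochains ?I (neg_vars e) (q - 1).
        \<forall>xs. set xs \<subseteq> ?I \<longrightarrow> face_sum b xs = Poly_Mapping.lookup (c xs) e"
      if "e \<in> exponents r l a" for e
    proof -
      have "cov_exact TYPE('k) ?I (neg_vars e) q" using ex that by blast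
      moreover have "(\<lambda>xs. Poly_Mapping.lookup (c xs) e) \<in> cov_cochains ?I (neg_vars e) q"
        using c by (simp add: mem_cech_cochains_iff)
      moreover have "\<forall>xs. set xs \<subseteq> ?I \<longrightarrow> face_sum (\<lambda>xs. Poly_Mapping.lookup (c xs) e) xs = 0"
        using cocycle by (simp add: cech_diff_eq_0_iff flip: lookup_face_sum)
      ultimately show ?thesis unfolding cov_exact_def by blast
    qed
    then obtain B where B: "\<And>e. e \<in> exponents r l a \<Longrightarrow> B e \<in> cov_cochains ?I (neg_vars e) (q - 1)"
      and Bc: "\<And>e xs. e \<in> exponents r l a \<Longrightarrow> set xs \<subseteq> ?I \<Longrightarrow>
                 face_sum (B e) xs = Poly_Mapping.lookup (c xs) e"
      by metis
    \<comment> \<open>The primitives chosen for the exponents must add up to a Laurent polynomial on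
      each tuple. There are finitely many tuples of the relevant length, so only finitely many
      exponents occur in \<open>c\<close>, and the sum can be restricted to these.\<close>
    define E where "E = (\<Union>xs\<in>{xs. set xs \<subseteq> ?I \<and> length xs = nat (q + 1)}. Poly_Mapping.keys (c xs))"
    have "finite ?I" unfolding std_cover_def by (intro finite_PiE) auto
    then have finE: "finite E"
      unfolding E_def by (intro finite_UN_I finite_lists_length_eq) auto
    have E1: "e \<in> E" if "Poly_Mapping.lookup (c xs) e \<noteq> 0" for xs e
    proof -
      have cc: "(\<lambda>xs. Poly_Mapping.lookup (c xs) e) \<in> cov_cochains ?I (neg_vars e) q"
        using c by (simp add: mem_cech_cochains_iff)
      have "set xs \<subseteq> ?I" "int (length xs) = q + 1" using cov_cochainsD[OF cc that] by auto
      then show ?thesis using that unfolding E_def by (auto simp: in_keys_iff)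
    qed
    have E2: "E \<subseteq> exponents r l a"
      using c unfolding E_def mem_cech_cochains_iff by (auto simp: in_keys_iff)
    define b where "b = (\<lambda>xs. \<Sum>e\<in>E. Poly_Mapping.single e (B e xs))"
    have lb: "(\<lambda>xs. Poly_Mapping.lookup (b xs) e) = (if e \<in> E then B e else (\<lambda>_. 0))" for e
      using finE by (auto simp: b_def lookup_sum lookup_single fun_eq_iff when_def)
    have "b \<in> cech_cochains ?I ?F (q - 1)"
      unfolding mem_cech_cochains_iff
    proof (intro conjI allI impI)
      show "(\<lambda>xs. Poly_Mapping.lookup (b xs) e) \<in> cov_cochains ?I (neg_vars e) (q - 1)" for e
        using B E2 by (auto simp: lb) (simp add: cov_cochains_def)
      show "Poly_Mapping.lookup (b xs) e = 0" if "e \<notin> exponents r l a" for e xs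
        using that E2 fun_cong[OF lb[of e], of xs] by auto
    qed
    moreover have "c xs = cech_diff ?I b xs" for xs
    proof (rule poly_mapping_eqI)
      fix e
      show "Poly_Mapping.lookup (c xs) e = Poly_Mapping.lookup (cech_diff ?I b xs) e"
      proof (cases "set xs \<subseteq> ?I")
        case True
        then have "Poly_Mapping.lookup (cech_diff ?I b xs) e =
            face_sum (if e \<in> E then B e else (\<lambda>_. 0)) xs"
          by (simp add: cech_diff_eq lookup_face_sum lb)
        then show ?thesis using Bc True E1[of xs e] E2 by (auto simp: face_sum_0)
      next
        case False
        then have "c xs = 0" using c unfolding cech_cochains_def cech_tuples_def by blast
        then show ?thesis using False by (simp add: cech_diff_eq)
      qed
    qed
    ultimately show ?thesis by (intro image_eqI[of _ _ b]) auto
  qed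
  then show "is_zero (cohom r l q a :: ('k, _) subquot)"
    unfolding is_zero_def cohom_def cech_cohomology_def by auto
qed

text \<open>Only exponents whose variables have, in each factor, either all negative or all
  nonnegative exponents can contribute. The first forces \<open>a k < - int (l k)\<close>, the
  second \<open>a k \<ge> 0\<close>, so \<open>a\<close> determines the negative variables and the
  box lemma gives the one possible degree.\<close>

theorem is_zero_cohom:
  "is_zero (cohom r l q a :: ('k::field, _) subquot) \<longleftrightarrow>
     (\<exists>k\<in>{1..r}. - int (l k) \<le> a k \<and> a k < 0) \<or>
     q \<noteq> (\<Sum>k\<in>{k\<in>{1..r}. a k < - int (l k)}. int (l k))"
  (is "_ \<longleftrightarrow> ?dead \<or> _")
proof -
  define J where "J = {k\<in>{1..r}. a k < - int (l k)}"
  define N where "N = (SIGMA k:J. {..l k})"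
  have box: "cov_exact TYPE('k) (std_cover r l) N q \<longleftrightarrow> q \<noteq> (\<Sum>k\<in>J. int (l k))"
    unfolding std_cover_def N_def by (subst cov_exact_box) (auto simp: J_def)
  have e_cases: "cov_exact TYPE('k) (std_cover r l) (neg_vars e) q \<or> (neg_vars e = N \<and> \<not> ?dead)"
    if e: "e \<in> exponents r l a" for e
  proof (cases "\<exists>k\<in>{1..r}. \<exists>w\<le>l k. \<exists>i. (k, w) \<notin> neg_vars e \<and> (k, i) \<in> neg_vars e")
    case True
    then show ?thesis unfolding std_cover_def using cov_exact_acyclic[of _ "{1..r}" _ "\<lambda>k. {..l k}"]
      by blast
  next
    case False
    have neg: "k \<in> {1..r} \<and> i \<le> l k" if "(k, i) \<in> neg_vars e" for k i
    proof -
      have "(k, i) \<in> Poly_Mapping.keys e" using that by (auto simp: neg_vars_def in_keys_iff)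
      then show ?thesis using e by (auto simp: exponents_def)
    qed
    have sum_e: "(\<Sum>i\<le>l k. Poly_Mapping.lookup e (k, i)) = a k" if "k \<in> {1..r}" for k
      using e that by (simp add: exponents_def)
    have full: "a k < - int (l k)" if k: "k \<in> {1..r}" and "\<And>i. i \<le> l k \<Longrightarrow> (k, i) \<in> neg_vars e" for k
    proof -
      have "(\<Sum>i\<le>l k. Poly_Mapping.lookup e (k, i)) \<le> (\<Sum>i\<le>l k. - 1)"
        using that by (intro sum_mono) (force simp: neg_vars_def)
      then show ?thesis using sum_e[OF k] by simp
    qed
    have empty: "a k \<ge> 0" if k: "k \<in> {1..r}" and "\<And>i. i \<le> l k \<Longrightarrow> (k, i) \<notin> neg_vars e" for k
      unfolding sum_e[OF k, symmetric] using that by (intro sum_nonneg) (force simp: neg_vars_def)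
    have mem: "(k, i) \<in> neg_vars e \<longleftrightarrow> a k < - int (l k)" if k: "k \<in> {1..r}" "i \<le> l k" for k i
    proof (cases "(k, i) \<in> neg_vars e")
      case True
      then show ?thesis using False full k by blast
    next
      case nin: False
      then have "\<And>j. j \<le> l k \<Longrightarrow> (k, j) \<notin> neg_vars e" using False k by blast
      then have "a k \<ge> 0" using empty[OF k(1)] by blast
      then show ?thesis using nin by simp
    qed
    have "(k, i) \<in> neg_vars e \<longleftrightarrow> (k, i) \<in> N" for k i
    proof -
      have "(k, i) \<in> N \<longleftrightarrow> k \<in> {1..r} \<and> i \<le> l k \<and> a k < - int (l k)"
        by (auto simp: N_def J_def)
      then show ?thesis using mem[of k i] neg[of k i] by blast
    qed
    then have "neg_vars e = N" by auto
    moreover have "\<not> ?dead"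
    proof
      assume ?dead
      then obtain k where k: "k \<in> {1..r}" "- int (l k) \<le> a k" "a k < 0" by blast
      obtain w where "w \<le> l k" "(k, w) \<notin> neg_vars e" using full[OF k(1)] k by fastforce
      moreover obtain i where "i \<le> l k" "(k, i) \<in> neg_vars e" using empty[OF k(1)] k by fastforce
      ultimately show False using False k by blast
    qed
    ultimately show ?thesis by blast
  qed
  have witness: "\<exists>e\<in>exponents r l a. neg_vars e = N" if not_dead: "\<not> ?dead"
  proof -
    \<comment> \<open>A monomial with negative variables exactly \<open>N\<close>: in the factors of
      \<open>J\<close> all exponents are \<open>-1\<close> except the first, which takes the
      remaining \<open>a k + int (l k) < 0\<close>; elsewhere the first variable carries the whole
      degree.\<close>
    define f :: "nat \<times> nat \<Rightarrow> int" where
      "f = (\<lambda>(k, i). if k \<in> {1..r} \<and> i \<le> l k then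
              if k \<in> J then if i = 0 then a k + int (l k) else - 1
              else if i = 0 then a k else 0 else 0)"
    have f0: "f x \<noteq> 0 \<Longrightarrow> x \<in> (SIGMA k:{1..r}. {..l k})" for x
      by (cases x) (auto simp: f_def split: if_splits)
    then have "finite {x. f x \<noteq> 0}"
      by (intro finite_subset[of "{x. f x \<noteq> 0}" "SIGMA k:{1..r}. {..l k}"]) auto
    then have le: "Poly_Mapping.lookup (Abs_poly_mapping f) = f" by simp
    have "(\<Sum>i\<le>l k. f (k, i)) = a k" if "k \<in> {1..r}" for k
      using that by (auto simp: f_def sum.atMost_shift)
    then have "Abs_poly_mapping f \<in> exponents r l a"
      using f0 by (auto simp: exponents_def in_keys_iff le)
    moreover have "neg_vars (Abs_poly_mapping f) = N"
      using not_dead unfolding neg_vars_def le N_def J_def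
      by (force simp: f_def J_def split: if_splits)
    ultimately show ?thesis by blast
  qed
  show ?thesis
    unfolding is_zero_cohom_iff J_def[symmetric] using box e_cases witness by metis
qed

section \<open>Vanishing of the summands of the Weyman complex\<close>

lemma zero_mem_numer_cohom: "0 \<in> numer (cohom r l q a)"
proof -
  have "(\<lambda>_. 0) \<in> cech_cochains (std_cover r l) (line_bundle_sections r l a) q"
    by (simp add: cech_cochains_def line_bundle_sections_0)
  then show ?thesis
    by (simp add: cohom_def cech_cohomology_def cech_diff_eq_0_iff face_sum_0 zero_fun_def)
qed

lemma zero_mem_numer_weyman_summand: "0 \<in> numer (weyman_summand r l d \<nu> m p)"
  by (simp add: weyman_summand_def direct_power_def direct_sum_def zero_mem_numer_cohom)

lemma is_zero_weyman_summand:
  assumes "p \<le> dim_X r l + 1"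
  shows "is_zero (weyman_summand r l d \<nu> m p :: ('k::field, _) subquot) \<longleftrightarrow>
    is_zero (cohom r l (int p - \<nu>) (\<lambda>k. m k - int p * int (d k)) :: ('k, _) subquot)"
proof -
  \<comment> \<open>The binomial coefficient is positive, so the direct power is not an empty sum,
    which would vanish for the wrong reason.\<close>
  have "{..<dim_X r l + 1 choose p} \<noteq> {}" using assms by (simp add: lessThan_empty_iff)
  then show ?thesis
    unfolding weyman_summand_def direct_power_def
    by (subst is_zero_direct_sum) (auto simp: zero_mem_numer_cohom)
qed

lemma is_zero_weyman_term:
  "is_zero (weyman_term r l d \<nu> m :: ('k::field, _) subquot) \<longleftrightarrow>
    (\<forall>p\<in>{0..dim_X r l + 1}. is_zero (weyman_summand r l d \<nu> m p :: ('k, _) subquot))"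
  unfolding weyman_term_def by (rule is_zero_direct_sum) (rule zero_mem_numer_weyman_summand)

section \<open>Dimension of the zeroth Weyman term\<close>

text \<open>A linear map that is defined on \<open>numer Q\<close> and has kernel
  \<open>denom Q\<close> there identifies the quotient with its image. Sets of basis representatives
  correspond to bases of the image, so the choice made in \<open>quot_dim\<close> does not affect
  the cardinality.\<close>

lemma (in vector_space) quot_dim_eq_dim:
  fixes Q :: "('a, 'v::ab_group_add) subquot" and \<phi> :: "'v \<Rightarrow> 'b"
  assumes diff: "\<And>x y. \<phi> (x - y) = \<phi> x - \<phi> y"
    and scl: "\<And>\<alpha> x. \<phi> (scl Q \<alpha> x) = scale \<alpha> (\<phi> x)"
    and numer_0: "0 \<in> numer Q"
    and numer_diff: "\<And>x y. x \<in> numer Q \<Longrightarrow> y \<in> numer Q \<Longrightarrow> x - y \<in> numer Q"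
    and numer_scl: "\<And>\<alpha> x. x \<in> numer Q \<Longrightarrow> scl Q \<alpha> x \<in> numer Q"
    and ker: "\<And>x. x \<in> numer Q \<Longrightarrow> x \<in> denom Q \<longleftrightarrow> \<phi> x = 0"
  shows "quot_dim Q = dim (\<phi> ` numer Q)"
proof -
  have \<phi>_0: "\<phi> 0 = 0" using diff[of 0 0] by simp
  have \<phi>_add: "\<phi> (x + y) = \<phi> x + \<phi> y" for x y
    using diff[of "x + y" y] by simp
  have numer_add: "x + y \<in> numer Q" if "x \<in> numer Q" "y \<in> numer Q" for x y
    using numer_diff[OF that(1) numer_diff[OF numer_0 that(2)]] by simp
  define comb where "comb T c = (\<Sum>v\<in>T. scl Q (c v) v)" for T and c :: "'v \<Rightarrow> 'a"
  have comb_numer: "comb T c \<in> numer Q" if "finite T" "T \<subseteq> numer Q" for T c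
    using that unfolding comb_def
    by (induction T rule: finite_induct) (auto intro: numer_0 numer_add numer_scl)
  have \<phi>_comb: "\<phi> (comb T c) = (\<Sum>v\<in>T. scale (c v) (\<phi> v))" for T c
    unfolding comb_def by (induction T rule: infinite_finite_induct) (auto simp: \<phi>_0 \<phi>_add scl)
  have comb_denom: "comb T c \<in> denom Q \<longleftrightarrow> (\<Sum>v\<in>T. scale (c v) (\<phi> v)) = 0"
    if "finite T" "T \<subseteq> numer Q" for T c
    using ker[OF comb_numer[OF that]] \<phi>_comb by simp
  have basis_iff: "quot_basis Q S \<longleftrightarrow> inj_on \<phi> S \<and> independent (\<phi> ` S) \<and> \<phi> ` numer Q \<subseteq> span (\<phi> ` S)"
    if S: "S \<subseteq> numer Q" for S
  proof
    assume basis: "quot_basis Q S"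
    have indep: "c v = 0"
      if "finite T" "T \<subseteq> S" "(\<Sum>v\<in>T. scale (c v) (\<phi> v)) = 0" "v \<in> T" for T c v
    proof -
      have "comb T c \<in> denom Q" using comb_denom that S by blast
      then show ?thesis using basis that unfolding quot_basis_def comb_def by blast
    qed
    have inj: "inj_on \<phi> S"
    proof (rule inj_onI, rule ccontr)
      fix v w assume vw: "v \<in> S" "w \<in> S" "\<phi> v = \<phi> w" "v \<noteq> w"
      \<comment> \<open>Two representatives with the same image would satisfy the nontrivial
        relation \<open>v - w\<close> modulo \<open>denom Q\<close>.\<close>
      then have "(\<Sum>u\<in>{v, w}. scale (if u = v then 1 else - 1) (\<phi> u)) = 0" by simp
      from indep[OF _ _ this, of v] vw show False by simp
    qed
    moreover have "independent (\<phi> ` S)"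
      unfolding independent_explicit_finite_subsets
    proof (intro allI impI ballI)
      fix T' u w
      assume T': "T' \<subseteq> \<phi> ` S" "finite T'" and z: "(\<Sum>v\<in>T'. scale (u v) v) = 0" and w: "w \<in> T'"
      from T'(1) obtain T where T: "T \<subseteq> S" "T' = \<phi> ` T" "inj_on \<phi> T"
        by (metis subset_image_inj)
      then have "finite T" using T'(2) by (simp add: finite_image_iff)
      moreover have "(\<Sum>v\<in>T. scale (u (\<phi> v)) (\<phi> v)) = 0"
        using z T by (simp add: sum.reindex)
      moreover obtain v where "v \<in> T" "w = \<phi> v" using w T by blast
      ultimately show "u w = 0" using indep[of T "\<lambda>v. u (\<phi> v)" v] T by simp
    qed
    moreover have "\<phi> z \<in> span (\<phi> ` S)" if z: "z \<in> numer Q" for z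
    proof -
      have "\<exists>T c. finite T \<and> T \<subseteq> S \<and> z - comb T c \<in> denom Q"
        using basis z unfolding quot_basis_def comb_def by metis
      then obtain T c where T: "finite T" "T \<subseteq> S" "z - comb T c \<in> denom Q"
        by metis
      then have "z - comb T c \<in> numer Q" using z S comb_numer numer_diff by blast
      then have "\<phi> (z - comb T c) = 0" using ker T(3) by blast
      then have "\<phi> z = (\<Sum>v\<in>T. scale (c v) (\<phi> v))" by (simp add: diff \<phi>_comb)
      also have "\<dots> \<in> span (\<phi> ` S)"
        using T(2) by (intro span_sum span_scale span_base) auto
      finally show ?thesis .
    qed
    ultimately show "inj_on \<phi> S \<and> independent (\<phi> ` S) \<and> \<phi> ` numer Q \<subseteq> span (\<phi> ` S)" by blast
  next
    assume R: "inj_on \<phi> S \<and> independent (\<phi> ` S) \<and> \<phi> ` numer Q \<subseteq> span (\<phi> ` S)"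
    show "quot_basis Q S"
      unfolding quot_basis_def comb_def[symmetric]
    proof (intro conjI allI impI ballI)
      fix T and c :: "'v \<Rightarrow> 'a" and v
      assume T: "finite T" "T \<subseteq> S" and z: "comb T c \<in> denom Q" and v: "v \<in> T"
      have injT: "inj_on \<phi> T" using R T inj_on_subset by blast
      have "(\<Sum>v\<in>T. scale (c v) (\<phi> v)) = 0" using comb_denom T z S by blast
      then have "(\<Sum>w\<in>\<phi> ` T. scale (c (inv_into T \<phi> w)) w) = 0"
        using injT by (simp add: sum.reindex)
      moreover have "\<phi> ` T \<subseteq> \<phi> ` S" "finite (\<phi> ` T)" using T by auto
      moreover have "\<forall>A\<subseteq>\<phi> ` S. finite A \<longrightarrow> (\<forall>u. (\<Sum>v\<in>A. scale (u v) v) = 0 \<longrightarrow> (\<forall>v\<in>A. u v = 0))"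
        using conjunct1[OF conjunct2[OF R]] by (simp only: independent_explicit_finite_subsets)
      ultimately have "\<forall>w\<in>\<phi> ` T. c (inv_into T \<phi> w) = 0"
        by (elim allE[of _ "\<phi> ` T"] allE[of _ "\<lambda>w. c (inv_into T \<phi> w)"] impE) assumption+
      then show "c v = 0" using v injT by simp
    next
      fix z assume z: "z \<in> numer Q"
      then have "\<phi> z \<in> span (\<phi> ` S)" using R by blast
      then obtain T' u where T': "finite T'" "T' \<subseteq> \<phi> ` S" "\<phi> z = (\<Sum>w\<in>T'. scale (u w) w)"
        unfolding span_explicit by auto
      from T'(2) obtain T where T: "T \<subseteq> S" "T' = \<phi> ` T" "inj_on \<phi> T"
        by (metis subset_image_inj)
      have finT: "finite T" using T T' by (simp add: finite_image_iff)
      define c where "c = (\<lambda>v. u (\<phi> v))"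
      have "\<phi> (z - comb T c) = 0"
        using T T' by (simp add: diff \<phi>_comb c_def sum.reindex)
      moreover have "z - comb T c \<in> numer Q"
        using z finT T S comb_numer numer_diff by blast
      ultimately have "z - comb T c \<in> denom Q" using ker by blast
      then show "\<exists>T c. finite T \<and> T \<subseteq> S \<and> z - comb T c \<in> denom Q" using finT T by blast
    qed (use S in auto)
  qed
  \<comment> \<open>A basis of the image is lifted to representatives, so that \<open>SOME\<close>
    picks an actual basis.\<close>
  obtain B where B: "B \<subseteq> \<phi> ` numer Q" "independent B" "\<phi> ` numer Q \<subseteq> span B"
    by (rule maximal_independent_subset)
  from B(1) obtain S where "S \<subseteq> numer Q" "B = \<phi> ` S" "inj_on \<phi> S"
    by (metis subset_image_inj)
  then have "\<exists>S. quot_basis Q S" using B basis_iff by blast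
  then have some: "quot_basis Q (SOME S. quot_basis Q S)" by (rule someI_ex)
  then have sub: "(SOME S. quot_basis Q S) \<subseteq> numer Q" unfolding quot_basis_def by blast
  with some basis_iff have "inj_on \<phi> (SOME S. quot_basis Q S)"
    "independent (\<phi> ` (SOME S. quot_basis Q S))"
    "\<phi> ` numer Q \<subseteq> span (\<phi> ` (SOME S. quot_basis Q S))" by metis+
  then show ?thesis
    using basis_card_eq_dim[of "\<phi> ` (SOME S. quot_basis Q S)" "\<phi> ` numer Q"] sub
    by (simp add: quot_dim_def card_image image_mono)
qed

section \<open>Polynomials of a given multidegree and their monomials\<close>

lemma lookup_laurent_scale [simp]:
  "Poly_Mapping.lookup (laurent_scale \<alpha> f) e = \<alpha> * Poly_Mapping.lookup f e"
  by (simp add: laurent_scale_def Poly_Mapping.map.rep_eq when_def)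

interpretation laurent: vector_space "laurent_scale :: 'k::field \<Rightarrow> 'k laurent \<Rightarrow> 'k laurent"
  by unfold_locales (auto intro!: poly_mapping_eqI simp: lookup_add algebra_simps)

definition monomials :: "nat \<Rightarrow> (nat \<Rightarrow> nat) \<Rightarrow> (nat \<Rightarrow> int) \<Rightarrow> ((nat \<times> nat) \<Rightarrow>\<^sub>0 int) set" where
  "monomials r l a = {e \<in> exponents r l a. neg_vars e = {}}"

text \<open>With no chart given no variable is inverted, so the empty set stands for the global
  sections, which are the multihomogeneous polynomials.\<close>

lemma mem_line_bundle_sections_empty_iff:
  "f \<in> line_bundle_sections r l a {} \<longleftrightarrow> Poly_Mapping.keys f \<subseteq> monomials r l a"
  by (auto simp: mem_line_bundle_sections_iff monomials_def covers_def in_keys_iff subset_iff)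

lemma dim_line_bundle_sections_empty:
  "laurent.dim (line_bundle_sections r l a {} :: 'k::field laurent set) = card (monomials r l a)"
proof (rule laurent.dim_unique)
  let ?x = "\<lambda>e :: (nat \<times> nat) \<Rightarrow>\<^sub>0 int. Poly_Mapping.single e (1 :: 'k)"
  let ?B = "?x ` monomials r l a"
  have inj: "inj ?x"
  proof (rule injI)
    fix e e' assume "?x e = ?x e'"
    then have "Poly_Mapping.lookup (?x e) e = Poly_Mapping.lookup (?x e') e" by (rule arg_cong)
    then show "e = e'" by (simp add: lookup_single when_def split: if_splits)
  qed
  show "?B \<subseteq> line_bundle_sections r l a {}"
    unfolding image_subset_iff mem_line_bundle_sections_empty_iff by simp
  show "card ?B = card (monomials r l a)"
    using inj by (simp add: card_image inj_on_subset)
  show "(line_bundle_sections r l a {} :: 'k laurent set) \<subseteq> laurent.span ?B"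
  proof
    fix f :: "'k laurent" assume f: "f \<in> line_bundle_sections r l a {}"
    have "f = (\<Sum>e\<in>Poly_Mapping.keys f. laurent_scale (Poly_Mapping.lookup f e) (?x e))"
      by (rule poly_mapping_eqI) (auto simp: lookup_sum lookup_single when_def if_distrib[of "(*) _"] in_keys_iff cong: if_cong)
    also have "\<dots> \<in> laurent.span ?B"
      using f unfolding mem_line_bundle_sections_empty_iff
      by (intro laurent.span_sum laurent.span_scale laurent.span_base) auto
    finally show "f \<in> laurent.span ?B" .
  qed
  show "laurent.independent ?B"
    unfolding laurent.independent_explicit_finite_subsets
  proof (intro allI impI ballI)
    fix T u v
    assume T: "T \<subseteq> ?B" "finite T" and z: "(\<Sum>v\<in>T. laurent_scale (u v) v) = 0" and v: "v \<in> T"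
    from v T obtain e where e: "v = ?x e" by blast
    have "Poly_Mapping.lookup w e = (if w = v then 1 else 0)" if "w \<in> T" for w
      using that T e inj by (auto simp: lookup_single when_def dest: injD)
    then have "Poly_Mapping.lookup (\<Sum>v\<in>T. laurent_scale (u v) v) e = (\<Sum>w\<in>T. if w = v then u w else 0)"
      unfolding lookup_sum by (intro sum.cong) auto
    also have "\<dots> = u v" using T v by simp
    finally show "u v = 0" using z by simp
  qed
qed

lemma monomials_nonneg:
  assumes "e \<in> monomials r l a"
  shows "Poly_Mapping.lookup e x \<ge> 0"
proof -
  have "x \<notin> neg_vars e" using assms by (simp add: monomials_def)
  then show ?thesis by (simp add: neg_vars_def)
qed

text \<open>Nonnegative exponents with sum \<open>a k\<close> lie between \<open>0\<close> and
  \<open>a k\<close>, so restriction to the available variables embeds the monomials into a finite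
  box.\<close>

lemma finite_monomials: "finite (monomials r l a)"
proof -
  let ?A = "SIGMA k:{1..r}. {..l k}"
  have "inj_on (\<lambda>e. restrict (Poly_Mapping.lookup e) ?A) (monomials r l a)"
  proof (rule inj_onI, rule poly_mapping_eqI)
    fix e e' x
    assume e: "e \<in> monomials r l a" "e' \<in> monomials r l a"
      and eq: "restrict (Poly_Mapping.lookup e) ?A = restrict (Poly_Mapping.lookup e') ?A"
    show "Poly_Mapping.lookup e x = Poly_Mapping.lookup e' x"
    proof (cases "x \<in> ?A")
      case True
      then show ?thesis using fun_cong[OF eq, of x] by simp
    next
      case False
      then have "x \<notin> Poly_Mapping.keys e" "x \<notin> Poly_Mapping.keys e'"
        using e by (auto simp: monomials_def exponents_def)
      then show ?thesis by (simp add: in_keys_iff)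
    qed
  qed
  moreover have "(\<lambda>e. restrict (Poly_Mapping.lookup e) ?A) ` monomials r l a \<subseteq>
      (\<Pi>\<^sub>E (k, i)\<in>?A. {0..a k})"
  proof -
    have "Poly_Mapping.lookup e (k, i) \<in> {0..a k}"
      if e: "e \<in> monomials r l a" and k: "k \<in> {1..r}" "i \<le> l k" for e k i
    proof -
      have nonneg: "Poly_Mapping.lookup e x \<ge> 0" for x by (rule monomials_nonneg[OF e])
      have "Poly_Mapping.lookup e (k, i) \<le> (\<Sum>i\<le>l k. Poly_Mapping.lookup e (k, i))"
        using nonneg k by (intro member_le_sum) auto
      then show ?thesis using e k nonneg by (simp add: monomials_def exponents_def)
    qed
    then show ?thesis by (auto simp: PiE_iff split: if_splits)
  qed
  moreover have "finite (\<Pi>\<^sub>E (k, i)\<in>?A. {0..a k})" by (intro finite_PiE) auto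
  ultimately show ?thesis by (metis finite_imageD finite_subset)
qed

text \<open>Multiplication by the monomial with exponent \<open>b k - a k\<close> at the first
  variable of each factor is injective.\<close>

lemma card_monomials_mono:
  assumes le: "\<And>k. k \<in> {1..r} \<Longrightarrow> a k \<le> b k"
  shows "card (monomials r l a) \<le> card (monomials r l b)"
proof (rule card_inj_on_le)
  define t where "t = (\<Sum>k\<in>{1..r}. Poly_Mapping.single (k, 0::nat) (b k - a k))"
  have t: "Poly_Mapping.lookup t (k, i) = (if k \<in> {1..r} \<and> i = 0 then b k - a k else 0)" for k i
  proof -
    have "Poly_Mapping.lookup t (k, i) = (\<Sum>k'\<in>{1..r}. if k = k' then (if i = 0 then b k' - a k' else 0) else 0)"
      unfolding t_def lookup_sum by (intro sum.cong) (auto simp: lookup_single when_def)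
    then show ?thesis by simp
  qed
  show "inj_on (\<lambda>e. e + t) (monomials r l a)" by (auto intro: inj_onI)
  show "(\<lambda>e. e + t) ` monomials r l a \<subseteq> monomials r l b"
  proof (intro image_subsetI)
    fix e assume e: "e \<in> monomials r l a"
    have "Poly_Mapping.keys (e + t) \<subseteq> (SIGMA k:{1..r}. {..l k})"
    proof
      fix x assume "x \<in> Poly_Mapping.keys (e + t)"
      then have "x \<in> Poly_Mapping.keys e \<or> Poly_Mapping.lookup t x \<noteq> 0"
        by (auto simp: in_keys_iff lookup_add)
      then show "x \<in> (SIGMA k:{1..r}. {..l k})"
        using e by (cases x) (auto simp: t monomials_def exponents_def split: if_splits)
    qed
    moreover have "(\<Sum>i\<le>l k. Poly_Mapping.lookup (e + t) (k, i)) = b k" if "k \<in> {1..r}" for k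
      using e that by (simp add: lookup_add sum.distrib t monomials_def exponents_def)
    moreover have "Poly_Mapping.lookup (e + t) x \<ge> 0" for x
    proof -
      have "Poly_Mapping.lookup e x \<ge> 0" by (rule monomials_nonneg[OF e])
      moreover have "Poly_Mapping.lookup t x \<ge> 0" using le by (cases x) (simp add: t)
      ultimately show ?thesis by (simp add: lookup_add)
    qed
    ultimately show "e + t \<in> monomials r l b"
      by (auto simp: monomials_def exponents_def neg_vars_def not_less)
  qed
qed (rule finite_monomials)

section \<open>Cohomology in degree zero as the space of global sections\<close>

lemma mem_numer_cohom_iff:
  "c \<in> numer (cohom r l q a) \<longleftrightarrow> c \<in> cech_cochains (std_cover r l) (line_bundle_sections r l a) q \<and>
     (\<forall>xs. set xs \<subseteq> std_cover r l \<longrightarrow> face_sum c xs = 0)"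
  by (simp add: cohom_def cech_cohomology_def cech_diff_eq_0_iff)

lemma face_sum_laurent_scale:
  "face_sum (\<lambda>ys. laurent_scale \<alpha> (c ys)) xs = laurent_scale \<alpha> (face_sum c xs)"
  by (induction xs arbitrary: c) (simp_all add: laurent.scale_right_diff_distrib)

lemma numer_cohom_diff:
  fixes b c :: "(nat \<Rightarrow> nat) list \<Rightarrow> 'k::field laurent"
  assumes "b \<in> numer (cohom r l q a)" "c \<in> numer (cohom r l q a)"
  shows "b - c \<in> numer (cohom r l q a)"
proof -
  have "f - g \<in> line_bundle_sections r l a S"
    if "f \<in> line_bundle_sections r l a S" "g \<in> line_bundle_sections r l a S" for f g :: "'k laurent" and S
    unfolding mem_line_bundle_sections_iff
  proof (intro allI impI)
    fix e assume "Poly_Mapping.lookup (f - g) e \<noteq> 0"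
    then have "Poly_Mapping.lookup f e \<noteq> 0 \<or> Poly_Mapping.lookup g e \<noteq> 0"
      by (auto simp: lookup_minus)
    then show "e \<in> exponents r l a \<and> covers (neg_vars e) S"
      using that unfolding mem_line_bundle_sections_iff by blast
  qed
  then have "b - c \<in> cech_cochains (std_cover r l) (line_bundle_sections r l a) q"
    using assms by (simp add: mem_numer_cohom_iff cech_cochains_def)
  moreover have "face_sum (b - c) xs = face_sum b xs - face_sum c xs" for xs
    unfolding face_sum_diff[symmetric] fun_diff_def ..
  ultimately show ?thesis using assms by (simp add: mem_numer_cohom_iff)
qed

lemma numer_cohom_scale:
  fixes c :: "(nat \<Rightarrow> nat) list \<Rightarrow> 'k::field laurent"
  assumes "c \<in> numer (cohom r l q a)"
  shows "scl (cohom r l q a) \<alpha> c \<in> numer (cohom r l q a)"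
proof -
  have "laurent_scale \<alpha> f \<in> line_bundle_sections r l a S" if "f \<in> line_bundle_sections r l a S" for f :: "'k laurent" and S
    using that by (simp add: mem_line_bundle_sections_iff)
  then have "(\<lambda>xs. laurent_scale \<alpha> (c xs)) \<in> cech_cochains (std_cover r l) (line_bundle_sections r l a) q"
    using assms by (simp add: mem_numer_cohom_iff cech_cochains_def)
  moreover have "scl (cohom r l q a) \<alpha> c = (\<lambda>xs. laurent_scale \<alpha> (c xs))"
    by (simp add: cohom_def cech_cohomology_def)
  ultimately show ?thesis using assms by (simp add: mem_numer_cohom_iff face_sum_laurent_scale)
qed

text \<open>Tuples are nonempty, so the only cochain of degree \<open>-1\<close> is zero.\<close>

lemma denom_cohom_0: "denom (cohom r l 0 a :: ('k::field, _) subquot) = {0}"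
proof -
  have "cech_cochains (std_cover r l) (line_bundle_sections r l a :: _ \<Rightarrow> 'k laurent set) (- 1) = {\<lambda>_. 0}"
    by (auto simp: cech_cochains_def cech_tuples_def)
  moreover have "cech_diff I (\<lambda>_. 0 :: 'k laurent) = 0" for I :: "(nat \<Rightarrow> nat) set"
    by (simp add: fun_eq_iff cech_diff_eq face_sum_0)
  ultimately show ?thesis by (simp add: cohom_def cech_cohomology_def)
qed

definition const_cochain :: "'i set \<Rightarrow> 'v::zero \<Rightarrow> 'i list \<Rightarrow> 'v" where
  "const_cochain I f xs = (if \<exists>v\<in>I. xs = [v] then f else 0)"

text \<open>A 0-cocycle takes the same value on all charts. A variable occurring in it with negative
  exponent would be inverted on every single chart, but \<open>l k \<ge> 1\<close> provides charts
  that differ in the \<open>k\<close>-th coordinate.\<close>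

lemma numer_cohom_0:
  assumes l: "\<And>k. k \<in> {1..r} \<Longrightarrow> l k \<ge> 1"
  shows "numer (cohom r l 0 a) = const_cochain (std_cover r l) ` line_bundle_sections r l a {}"
proof (intro equalityI subsetI)
  let ?I = "std_cover r l" and ?F = "line_bundle_sections r l a"
  fix c assume c: "c \<in> numer (cohom r l 0 a)"
  then have cochain: "c \<in> cech_cochains ?I ?F 0"
    and cocycle: "\<And>xs. set xs \<subseteq> ?I \<Longrightarrow> face_sum c xs = 0"
    by (auto simp: mem_numer_cohom_iff)
  define v0 where "v0 = restrict (\<lambda>_. 0 :: nat) {1..r}"
  have v0: "v0 \<in> ?I" by (auto simp: std_cover_def v0_def)
  have const: "c [v] = c [v0]" if "v \<in> ?I" for v
    using cocycle[of "[v0, v]"] that v0 by simp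
  have secs: "c [v] \<in> ?F {v}" if "v \<in> ?I" for v
    using cochain that by (force simp: cech_cochains_def cech_tuples_def)
  have "c [v0] \<in> ?F {}"
    unfolding mem_line_bundle_sections_iff
  proof (intro allI impI)
    fix e assume nz: "Poly_Mapping.lookup (c [v0]) e \<noteq> 0"
    have e: "e \<in> exponents r l a \<and> covers (neg_vars e) {v}" if "v \<in> ?I" for v
      using secs[OF that] nz const[OF that] by (simp add: mem_line_bundle_sections_iff)
    have "x \<notin> neg_vars e" for x
    proof
      assume x: "x \<in> neg_vars e"
      then have "x \<in> Poly_Mapping.keys e" by (auto simp: neg_vars_def in_keys_iff)
      then obtain k i where k: "x = (k, i)" "k \<in> {1..r}"
        using e[OF v0] by (auto simp: exponents_def)
      \<comment> \<open>The charts \<open>v0\<close> and \<open>v0(k := 1)\<close> invert different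
        variables of factor \<open>k\<close>, so no \<open>i\<close> serves both.\<close>
      have "v0(k := 1) \<in> ?I"
        using k l[of k] by (auto simp: std_cover_def v0_def PiE_iff extensional_def)
      then have "(v0(k := 1)) k = i" "v0 k = i"
        using e v0 x k(1) unfolding covers_def by blast+
      then show False using k by (simp add: v0_def)
    qed
    then show "e \<in> exponents r l a \<and> covers (neg_vars e) {}"
      using e[OF v0] by (auto simp: covers_def)
  qed
  moreover have "c = const_cochain ?I (c [v0])"
  proof
    fix xs
    show "c xs = const_cochain ?I (c [v0]) xs"
    proof (cases "\<exists>v\<in>?I. xs = [v]")
      case True
      then show ?thesis using const by (auto simp: const_cochain_def)
    next
      case False
      then have "xs \<notin> cech_tuples ?I 0" by (auto simp: cech_tuples_def length_Suc_conv)
      then have "c xs = 0" using cochain by (auto simp: cech_cochains_def)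
      with False show ?thesis by (auto simp: const_cochain_def)
    qed
  qed
  ultimately show "c \<in> const_cochain ?I ` ?F {}" by blast
next
  let ?I = "std_cover r l" and ?F = "line_bundle_sections r l a"
  fix c assume "c \<in> const_cochain ?I ` ?F {}"
  then obtain f where f: "f \<in> ?F {}" and c: "c = const_cochain ?I f" by blast
  have "f \<in> ?F S" for S
    using f covers_mono[of _ "{}" S] unfolding mem_line_bundle_sections_iff by blast
  then have "c \<in> cech_cochains ?I ?F 0"
    by (auto simp: c cech_cochains_def cech_tuples_def const_cochain_def line_bundle_sections_0)
  moreover have "face_sum c xs = 0" if "set xs \<subseteq> ?I" for xs
  proof (cases "length xs = 2")
    case True
    then obtain v w where "xs = [v, w]" by (auto simp: length_Suc_conv numeral_2_eq_2)
    then show ?thesis using that by (simp add: c const_cochain_def)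
  next
    case False
    then show ?thesis by (intro face_sum_eq_0) (auto simp: c const_cochain_def)
  qed
  ultimately show "c \<in> numer (cohom r l 0 a)" by (simp add: mem_numer_cohom_iff)
qed

lemma numer_direct_sum_diff:
  assumes "\<And>i x y. i \<in> I \<Longrightarrow> x \<in> numer (Q i) \<Longrightarrow> y \<in> numer (Q i) \<Longrightarrow> x - y \<in> numer (Q i)"
    and "f \<in> numer (direct_sum I Q)" "g \<in> numer (direct_sum I Q)"
  shows "f - g \<in> numer (direct_sum I (Q :: _ \<Rightarrow> (_, _::ab_group_add) subquot))"
  using assms by (auto simp: direct_sum_def)

lemma numer_direct_sum_scale:
  assumes "\<And>i x. i \<in> I \<Longrightarrow> x \<in> numer (Q i) \<Longrightarrow> scl (Q i) \<alpha> x \<in> numer (Q i)"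
    and "\<And>i. scl (Q i) \<alpha> 0 = 0" and "f \<in> numer (direct_sum I Q)"
  shows "scl (direct_sum I Q) \<alpha> f \<in> numer (direct_sum I Q)"
  using assms by (auto simp: direct_sum_def)

lemma scl_cohom_0: "scl (cohom r l q a) \<alpha> 0 = 0"
  by (simp add: cohom_def cech_cohomology_def fun_eq_iff)

lemma scl_weyman_summand_0: "scl (weyman_summand r l d \<nu> m p) \<alpha> 0 = 0"
  unfolding weyman_summand_def direct_power_def
  by (simp add: direct_sum_def scl_cohom_0) (simp add: fun_eq_iff)

text \<open>Of the zeroth term only the summand \<open>p = 0\<close> survives. Evaluating it at one
  chart is a linear map with kernel the denominator and image the polynomials of multidegree
  \<open>m\<close>.\<close>

lemma matrix_rows_eq_card_monomials:
  assumes l: "\<And>k. k \<in> {1..r} \<Longrightarrow> l k \<ge> 1"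
    and syl: "gives_sylvester TYPE('k::field) r l d m"
  shows "matrix_rows TYPE('k) r l d m = card (monomials r l m)"
proof -
  let ?S = "weyman_summand r l d 0 m :: nat \<Rightarrow> ('k, _) subquot"
  let ?Q = "weyman_term r l d 0 m :: ('k, _) subquot"
  let ?H = "cohom r l 0 m :: ('k, _) subquot"
  let ?P = "{0..dim_X r l + 1}"
  define v0 where "v0 = restrict (\<lambda>_. 0 :: nat) {1..r}"
  have v0: "v0 \<in> std_cover r l" by (auto simp: std_cover_def v0_def)
  define \<phi> :: "(nat \<Rightarrow> nat \<Rightarrow> (nat \<Rightarrow> nat) list \<Rightarrow> 'k laurent) \<Rightarrow> 'k laurent"
    where "\<phi> f = f 0 0 [v0]" for f
  have numer_H: "numer ?H = const_cochain (std_cover r l) ` line_bundle_sections r l m {}"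
    using l by (rule numer_cohom_0)
  have S0: "?S 0 = direct_power 1 ?H" by (simp add: weyman_summand_def)
  \<comment> \<open>A 0-cocycle is constant, so its value at \<open>v0\<close> determines
    it.\<close>
  have \<phi>_0: "\<phi> f = 0 \<longleftrightarrow> f 0 0 = 0" if "f 0 \<in> numer (?S 0)" for f
  proof -
    have "f 0 0 \<in> numer ?H" using that by (simp add: S0 direct_power_def direct_sum_def)
    then obtain g where g: "f 0 0 = const_cochain (std_cover r l) g"
      using numer_H by blast
    then have \<phi>_f: "\<phi> f = g" using v0 by (simp add: \<phi>_def const_cochain_def)
    show ?thesis
    proof
      assume "\<phi> f = 0"
      then show "f 0 0 = 0" using g \<phi>_f by (simp add: const_cochain_def fun_eq_iff)
    qed (simp add: \<phi>_def)
  qed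
  have "quot_dim ?Q = laurent.dim (\<phi> ` numer ?Q)"
  proof (rule laurent.quot_dim_eq_dim)
    show "\<phi> (x - y) = \<phi> x - \<phi> y" for x y by (simp add: \<phi>_def)
    show "\<phi> (scl ?Q \<alpha> x) = laurent_scale \<alpha> (\<phi> x)" for \<alpha> x
      by (simp add: \<phi>_def weyman_term_def direct_sum_def weyman_summand_def direct_power_def
          cohom_def cech_cohomology_def)
    show "0 \<in> numer ?Q"
      by (simp add: weyman_term_def direct_sum_def zero_mem_numer_weyman_summand)
    show "x - y \<in> numer ?Q" if "x \<in> numer ?Q" "y \<in> numer ?Q" for x y
      using that unfolding weyman_term_def weyman_summand_def direct_power_def
      by (intro numer_direct_sum_diff numer_cohom_diff)
    show "scl ?Q \<alpha> x \<in> numer ?Q" if "x \<in> numer ?Q" for \<alpha> x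
      unfolding weyman_term_def
    proof (rule numer_direct_sum_scale)
      show "x \<in> numer (direct_sum ?P ?S)" using that by (simp add: weyman_term_def)
      show "scl (?S p) \<alpha> y \<in> numer (?S p)" if "y \<in> numer (?S p)" for p y
        using that unfolding weyman_summand_def direct_power_def
        by (intro numer_direct_sum_scale numer_cohom_scale scl_cohom_0)
    qed (rule scl_weyman_summand_0)
    show "x \<in> denom ?Q \<longleftrightarrow> \<phi> x = 0" if x: "x \<in> numer ?Q" for x
    proof -
      have x': "\<forall>p\<in>?P. x p \<in> numer (?S p)" "\<forall>p. p \<notin> ?P \<longrightarrow> x p = 0"
        using x by (auto simp: weyman_term_def direct_sum_def)
      have "x \<in> denom ?Q \<longleftrightarrow> (\<forall>p\<in>?P. x p \<in> denom (?S p))"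
        using x'(2) by (auto simp: weyman_term_def direct_sum_def)
      \<comment> \<open>The Sylvester condition enters here: every summand with
        \<open>p \<noteq> 0\<close> is zero, so membership in its denominator is automatic.\<close>
      also have "\<dots> \<longleftrightarrow> x 0 \<in> denom (?S 0)"
      proof -
        have "x p \<in> denom (?S p)" if "p \<in> ?P - {0}" for p
        proof -
          have "\<forall>p\<in>?P - {0}. is_zero (?S p)" using syl by (simp add: gives_sylvester_def)
          then have "numer (?S p) \<subseteq> denom (?S p)" using that unfolding is_zero_def by (rule bspec)
          moreover have "x p \<in> numer (?S p)" using x'(1) that by simp
          ultimately show ?thesis by (rule subsetD)
        qed
        then show ?thesis by (metis Diff_iff atLeastAtMost_iff le0 singletonD)
      qed
      also have "\<dots> \<longleftrightarrow> x 0 0 = 0"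
      proof -
        have "x 0 \<in> numer (?S 0)" using x'(1) by simp
        then have "\<forall>i. i \<notin> {..<1} \<longrightarrow> x 0 i = 0"
          unfolding S0 by (simp add: direct_power_def direct_sum_def)
        then show ?thesis by (simp add: S0 direct_power_def direct_sum_def denom_cohom_0 lessThan_Suc)
      qed
      also have "\<dots> \<longleftrightarrow> \<phi> x = 0" using \<phi>_0 x'(1) by simp
      finally show ?thesis .
    qed
  qed
  moreover have "\<phi> ` numer ?Q = line_bundle_sections r l m {}"
  proof (intro equalityI subsetI)
    fix f assume "f \<in> \<phi> ` numer ?Q"
    then obtain x where x: "x \<in> numer ?Q" "f = \<phi> x" by blast
    then have "x 0 \<in> numer (?S 0)" by (simp add: weyman_term_def direct_sum_def)
    then have "x 0 0 \<in> numer ?H" unfolding S0 by (simp add: direct_sum_def direct_power_def)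
    then show "f \<in> line_bundle_sections r l m {}"
      using v0 by (auto simp: numer_H x \<phi>_def const_cochain_def)
  next
    fix f :: "'k laurent" assume f: "f \<in> line_bundle_sections r l m {}"
    define c where "c = const_cochain (std_cover r l) f"
    have c: "c \<in> numer ?H" using f by (auto simp: numer_H c_def)
    define x where "x p i = (if p = 0 \<and> i = 0 then c else 0)" for p i :: nat
    have "x p \<in> numer (?S p)" for p
    proof (cases "p = 0")
      case True
      then show ?thesis using c by (simp add: S0 direct_power_def direct_sum_def x_def)
    next
      case False
      then have "x p = 0" by (simp add: x_def fun_eq_iff)
      then show ?thesis using zero_mem_numer_weyman_summand[of r l d 0 m p] by simp
    qed
    then have "x \<in> numer ?Q" by (auto simp: weyman_term_def direct_sum_def x_def fun_eq_iff)
    moreover have "\<phi> x = f" using v0 by (simp add: \<phi>_def x_def c_def const_cochain_def)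
    ultimately show "f \<in> \<phi> ` numer ?Q" by blast
  qed
  ultimately show ?thesis
    by (simp add: matrix_rows_def dim_line_bundle_sections_empty)
qed

section \<open>Existence of the permutation\<close>

text \<open>The ranks are assigned from the top: \<open>step\<close> finds the element that gets the largest rank.\<close>

lemma greedy_ranking:
  fixes P :: "'a \<Rightarrow> 'a set \<Rightarrow> bool"
  assumes fin: "finite A"
    and anti: "\<And>k U V. U \<subseteq> V \<Longrightarrow> V \<subseteq> A \<Longrightarrow> P k V \<Longrightarrow> P k U"
    and step: "\<And>U. U \<subseteq> A \<Longrightarrow> U \<noteq> {} \<Longrightarrow> (\<And>j. j \<in> A - U \<Longrightarrow> P j (insert j U)) \<Longrightarrow> \<exists>k\<in>U. P k U"
  obtains g where "bij_betw g A {1..card A}" "\<And>k. k \<in> A \<Longrightarrow> P k {j\<in>A. g j \<le> g k}"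
proof -
  \<comment> \<open>Induction over the set \<open>U\<close> of unranked elements. The invariant is
    that each element already removed could still be ranked if put back into
    \<open>U\<close>.\<close>
  have "\<exists>g. bij_betw g U {1..card U} \<and> (\<forall>k\<in>U. P k {j\<in>U. g j \<le> g k})"
    if "U \<subseteq> A" "\<And>j. j \<in> A - U \<Longrightarrow> P j (insert j U)" for U
    using that
  proof (induction "card U" arbitrary: U)
    case 0
    then have "U = {}" using finite_subset[OF 0(2) fin] by simp
    then show ?case by (simp add: bij_betw_def)
  next
    case (Suc n)
    have finU: "finite U" using Suc.prems fin finite_subset by blast
    have "U \<noteq> {}" using Suc.hyps(2) by auto
    then obtain k where k: "k \<in> U" "P k U" using step[OF Suc.prems(1)] Suc.prems(2) by blast
    have card: "card U = Suc n" "card (U - {k}) = n" using Suc.hyps(2) k finU by auto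
    have "\<exists>g. bij_betw g (U - {k}) {1..card (U - {k})} \<and>
        (\<forall>i\<in>U - {k}. P i {j\<in>U - {k}. g j \<le> g i})"
    proof (rule Suc.hyps(1))
      show "n = card (U - {k})" using card by simp
      show "U - {k} \<subseteq> A" using Suc.prems by blast
      fix j assume j: "j \<in> A - (U - {k})"
      show "P j (insert j (U - {k}))"
      proof (cases "j = k")
        case True
        then show ?thesis using k by (simp add: insert_absorb)
      next
        case False
        then have "P j (insert j U)" using j Suc.prems(2) by blast
        then show ?thesis by (rule anti[rotated 2]) (use j Suc.prems(1) in auto)
      qed
    qed
    then obtain g where g: "bij_betw g (U - {k}) {1..n}"
      "\<And>i. i \<in> U - {k} \<Longrightarrow> P i {j\<in>U - {k}. g j \<le> g i}"
      unfolding card by blast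
    \<comment> \<open>The chosen \<open>k\<close> gets the top rank; the sets of lower-ranked
      elements of the others do not contain it.\<close>
    define h where "h = g(k := Suc n)"
    have g_le: "g i \<le> n" if "i \<in> U - {k}" for i
      using bij_betwE[OF g(1)] that by auto
    have "bij_betw h (U - {k}) {1..n}"
      using g(1) by (rule bij_betw_cong[THEN iffD1, rotated]) (simp add: h_def)
    then have "bij_betw h (U - {k} \<union> {k}) ({1..n} \<union> {h k})"
      by (intro notIn_Un_bij_betw) (auto simp: h_def)
    moreover have "U - {k} \<union> {k} = U" "{1..n} \<union> {h k} = {1..card U}"
      using k card by (auto simp: h_def)
    ultimately have "bij_betw h U {1..card U}" by simp
    moreover have "P i {j\<in>U. h j \<le> h i}" if i: "i \<in> U" for i
    proof (cases "i = k")
      case True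
      have "{j\<in>U. h j \<le> h i} = U"
        using g_le True by (force simp: h_def)
      then show ?thesis using True k by simp
    next
      case False
      have "{j\<in>U. h j \<le> h i} = {j\<in>U - {k}. g j \<le> g i}"
        using g_le[of i] i False by (auto simp: h_def)
      then show ?thesis using g(2)[of i] i False by simp
    qed
    ultimately show ?case by blast
  qed
  from this[of A] show ?thesis using that by blast
qed

section \<open>Comparing Sylvester-type degree vectors with the permutation vectors\<close>

definition high_cohom_factors :: "nat \<Rightarrow> (nat \<Rightarrow> nat) \<Rightarrow> (nat \<Rightarrow> nat) \<Rightarrow> (nat \<Rightarrow> int) \<Rightarrow> nat \<Rightarrow> nat set" where
  "high_cohom_factors r l d m p = {k\<in>{1..r}. m k - int p * int (d k) < - int (l k)}"

lemma is_zero_weyman_summand_iff: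
  assumes "p \<le> dim_X r l + 1"
  shows "is_zero (weyman_summand r l d \<nu> m p :: ('k::field, _) subquot) \<longleftrightarrow>
    (\<exists>k\<in>{1..r}. - int (l k) \<le> m k - int p * int (d k) \<and> m k - int p * int (d k) < 0) \<or>
    int p - \<nu> \<noteq> (\<Sum>k\<in>high_cohom_factors r l d m p. int (l k))"
  unfolding is_zero_weyman_summand[OF assms] is_zero_cohom high_cohom_factors_def ..

lemma gives_sylvester_if_ge_perm_vector:
  fixes \<pi> :: "nat \<Rightarrow> nat"
  assumes l: "\<And>k. k \<in> {1..r} \<Longrightarrow> l k \<ge> 1" and d: "\<And>k. k \<in> {1..r} \<Longrightarrow> d k \<ge> 1"
    and ge: "\<And>k. k \<in> {1..r} \<Longrightarrow> m k \<ge> perm_vector r l d \<pi> k"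
  shows "gives_sylvester TYPE('k::field) r l d m"
proof -
  define S where "S k = (\<Sum>j\<in>{j\<in>{1..r}. \<pi> j \<ge> \<pi> k}. int (l j))" for k
  have ge': "(1 + S k) * int (d k) \<le> m k + int (l k)" if "k \<in> {1..r}" for k
    using ge[OF that] by (simp add: perm_vector_def S_def)
  \<comment> \<open>The sum in \<open>S k\<close> contains \<open>l k\<close> itself. This bound
    makes both required spaces of global sections nonzero.\<close>
  have md: "m k \<ge> int (d k)" if k: "k \<in> {1..r}" for k
  proof -
    have "int (l k) \<le> S k"
      unfolding S_def using k by (intro member_le_sum) auto
    then have "(1 + int (l k)) * int (d k) \<le> (1 + S k) * int (d k)"
      by (intro mult_right_mono) auto
    moreover have "int (l k) * 1 \<le> int (l k) * int (d k)"
      using d[OF k] by (intro mult_left_mono) auto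
    ultimately show ?thesis using ge'[OF k] by (simp add: algebra_simps)
  qed
  have top: "(\<Sum>k\<in>high_cohom_factors r l d m p. int (l k)) = 0 \<or>
      int p \<ge> (\<Sum>k\<in>high_cohom_factors r l d m p. int (l k)) + 2" for p
  proof (cases "high_cohom_factors r l d m p = {}")
    case False
    let ?J = "high_cohom_factors r l d m p"
    have J: "?J \<subseteq> {1..r}" "finite ?J" by (auto simp: high_cohom_factors_def)
    \<comment> \<open>For the factor \<open>k\<close> of \<open>?J\<close> with least
      \<open>\<pi> k\<close>, all of \<open>?J\<close> is counted in \<open>S k\<close>, and
      \<open>k \<in> ?J\<close> forces \<open>1 + S k < int p\<close>.\<close>
    then have "Min (\<pi> ` ?J) \<in> \<pi> ` ?J" using False by (intro Min_in) auto
    then obtain k where k: "k \<in> ?J" "\<pi> k = Min (\<pi> ` ?J)" by auto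
    then have "\<And>j. j \<in> ?J \<Longrightarrow> \<pi> k \<le> \<pi> j" using J by simp
    then have "(\<Sum>k\<in>?J. int (l k)) \<le> S k"
      unfolding S_def using J by (intro sum_mono2) auto
    moreover have "(1 + S k) * int (d k) < int p * int (d k)"
      using ge'[of k] k J by (force simp: high_cohom_factors_def)
    then have "1 + S k < int p" by (simp add: mult_less_cancel_right)
    ultimately show ?thesis by simp
  qed simp
  have nz: "\<not> is_zero (cohom r l 0 a :: ('k, _) subquot)" if a: "\<And>k. k \<in> {1..r} \<Longrightarrow> a k \<ge> 0" for a
  proof -
    have "\<not> a k < - int (l k)" "\<not> a k < 0" if "k \<in> {1..r}" for k
      using a[OF that] by auto
    then have J: "{k\<in>{1..r}. a k < - int (l k)} = {}"
      and "\<not> (\<exists>k\<in>{1..r}. - int (l k) \<le> a k \<and> a k < 0)" by blast+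
    then show ?thesis unfolding is_zero_cohom J by simp
  qed
  have m0: "0 \<le> m k" if "k \<in> {1..r}" for k using md[OF that] by linarith
  show ?thesis
    unfolding gives_sylvester_def is_zero_weyman_term
  proof (intro conjI ballI)
    fix p assume p: "p \<in> {0..dim_X r l + 1}"
    then show "is_zero (weyman_summand r l d (- 1) m p :: ('k, _) subquot)"
      using top[of p] by (subst is_zero_weyman_summand_iff) auto
  next
    fix p assume p: "p \<in> {0..dim_X r l + 1} - {1}"
    then show "is_zero (weyman_summand r l d 1 m p :: ('k, _) subquot)"
      using top[of p] by (subst is_zero_weyman_summand_iff) auto
  next
    fix p assume p: "p \<in> {0..dim_X r l + 1} - {0}"
    then show "is_zero (weyman_summand r l d 0 m p :: ('k, _) subquot)"
      using top[of p] by (subst is_zero_weyman_summand_iff) auto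
  qed (use m0 md nz in auto)
qed

lemma perm_vector_le_if_gives_sylvester:
  assumes l: "\<And>k. k \<in> {1..r} \<Longrightarrow> l k \<ge> 1" and d: "\<And>k. k \<in> {1..r} \<Longrightarrow> d k \<ge> 1"
    and syl: "gives_sylvester TYPE('k::field) r l d m"
  obtains \<pi> where "\<pi> permutes {1..r}" "\<And>k. k \<in> {1..r} \<Longrightarrow> m k \<ge> perm_vector r l d \<pi> k"
proof -
  \<comment> \<open>The inequality \<open>m k \<ge> perm_vector r l d \<pi> k\<close> with
    \<open>U\<close> in place of the set of \<open>j\<close> with
    \<open>\<pi> j \<ge> \<pi> k\<close>.\<close>
  define P where "P k U \<longleftrightarrow> (1 + (\<Sum>j\<in>U. int (l j))) * int (d k) \<le> m k + int (l k)" for k U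
  obtain g where g: "bij_betw g {1..r} {1..card {1..r}}"
    "\<And>k. k \<in> {1..r} \<Longrightarrow> P k {j\<in>{1..r}. g j \<le> g k}"
  proof (rule greedy_ranking[of "{1..r}" P])
    fix k U V assume UV: "U \<subseteq> V" "V \<subseteq> {1..r}" and P: "P k V"
    have "finite V" using UV finite_subset by blast
    then have "(\<Sum>j\<in>U. int (l j)) \<le> (\<Sum>j\<in>V. int (l j))" using UV by (intro sum_mono2) auto
    then have "(1 + (\<Sum>j\<in>U. int (l j))) * int (d k) \<le> (1 + (\<Sum>j\<in>V. int (l j))) * int (d k)"
      by (intro mult_right_mono) auto
    then show "P k U" using P unfolding P_def by linarith
  next
    fix U assume U: "U \<subseteq> {1..r}" "U \<noteq> {}" and out: "\<And>j. j \<in> {1..r} - U \<Longrightarrow> P j (insert j U)"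
    text \<open>Otherwise the cohomology of the twist with \<open>p = 1 + sum l U\<close> is concentrated in degree
      \<open>p - 1\<close>, the top cohomology occurring exactly at the factors in \<open>U\<close>.\<close>
    show "\<exists>k\<in>U. P k U"
    proof (rule ccontr)
      assume neg: "\<not> (\<exists>k\<in>U. P k U)"
      have finU: "finite U" using U finite_subset by blast
      define p where "p = 1 + sum l U"
      have p_int: "int p = 1 + (\<Sum>j\<in>U. int (l j))" by (simp add: p_def)
      have p_le: "p \<le> dim_X r l + 1"
        unfolding p_def dim_X_def using U by (auto intro!: sum_mono2)
      have "sum l U \<noteq> 0"
      proof -
        obtain u where "u \<in> U" using U by blast
        then have "l u \<le> sum l U" "l u \<ge> 1" using finU l U by (auto intro: member_le_sum)
        then show ?thesis by simp
      qed
      then have "p \<noteq> 1" by (simp add: p_def)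
      have inside: "m k - int p * int (d k) < - int (l k)" if "k \<in> U" for k
        using neg that by (auto simp: P_def p_int)
      \<comment> \<open>The invariant for \<open>k\<close> counts \<open>l k\<close> in addition to
        \<open>U\<close>; the surplus \<open>l k * d k\<close> absorbs the \<open>l k\<close> on the
        right.\<close>
      have outside: "0 \<le> m k - int p * int (d k)" if k: "k \<in> {1..r} - U" for k
      proof -
        have "(1 + (int (l k) + (\<Sum>j\<in>U. int (l j)))) * int (d k) \<le> m k + int (l k)"
          using out[OF k] k finU by (simp add: P_def)
        then have "int p * int (d k) + int (l k) * int (d k) \<le> m k + int (l k)"
          by (simp add: p_int algebra_simps)
        moreover have "int (l k) * 1 \<le> int (l k) * int (d k)"
          using d[of k] k by (intro mult_left_mono) auto
        ultimately show ?thesis by simp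
      qed
      have "high_cohom_factors r l d m p = U"
        using inside outside U unfolding high_cohom_factors_def by fastforce
      moreover have "\<not> (- int (l k) \<le> m k - int p * int (d k) \<and> m k - int p * int (d k) < 0)"
        if "k \<in> {1..r}" for k
        using inside[of k] outside[of k] that by fastforce
      ultimately have "\<not> is_zero (weyman_summand r l d 1 m p :: ('k, _) subquot)"
        unfolding is_zero_weyman_summand_iff[OF p_le] using p_int by auto
      moreover have "p \<in> {0..dim_X r l + 1} - {1}" using p_le \<open>p \<noteq> 1\<close> by simp
      then have "is_zero (weyman_summand r l d 1 m p :: ('k, _) subquot)"
        using syl by (simp add: gives_sylvester_def)
      ultimately show False by (rule notE)
    qed
  qed auto
  \<comment> \<open>The ranking collects the \<open>j\<close> with \<open>g j \<le> g k\<close>, the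
    permutation vector those with \<open>\<pi> j \<ge> \<pi> k\<close>, so the order is
    reversed.\<close>
  define \<pi> where "\<pi> j = (if j \<in> {1..r} then Suc r - g j else j)" for j
  have g_range: "g j \<in> {1..r}" if "j \<in> {1..r}" for j using bij_betwE[OF g(1)] that by simp
  have "bij_betw ((\<lambda>i. Suc r - i) \<circ> g) {1..r} {1..r}"
  proof (rule bij_betw_trans)
    show "bij_betw g {1..r} {1..r}" using g(1) by simp
    show "bij_betw (\<lambda>i. Suc r - i) {1..r} {1..r}"
      by (rule bij_betw_byWitness[where f' = "\<lambda>i. Suc r - i"]) auto
  qed
  then have "bij_betw \<pi> {1..r} {1..r}"
    by (rule bij_betw_cong[THEN iffD1, rotated]) (simp add: \<pi>_def)
  then have "\<pi> permutes {1..r}" by (rule bij_imp_permutes) (simp only: \<pi>_def if_False)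
  moreover have "m k \<ge> perm_vector r l d \<pi> k" if k: "k \<in> {1..r}" for k
  proof -
    have "{j\<in>{1..r}. \<pi> j \<ge> \<pi> k} = {j\<in>{1..r}. g j \<le> g k}"
      using g_range k by (force simp: \<pi>_def)
    then show ?thesis using g(2)[OF k] by (simp add: P_def perm_vector_def)
  qed
  ultimately show ?thesis using that by blast
qed

theorem theorem5p4:
  fixes r :: nat and l d :: "nat \<Rightarrow> nat"
  assumes "r \<ge> 1"
    and "\<And>k. k \<in> {1..r} \<Longrightarrow> l k \<ge> 1"
    and "\<And>k. k \<in> {1..r} \<Longrightarrow> d k \<ge> 1"
  shows
    "(\<forall>m :: nat \<Rightarrow> int. (\<forall>k\<in>{1..r}. 0 \<le> m k) \<longrightarrow>
        (gives_sylvester TYPE('k::{alg_closed_field, field_char_0}) r l d m \<longleftrightarrow>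
          (\<exists>\<pi>. \<pi> permutes {1..r} \<and> (\<forall>j\<in>{1..r}. m j \<ge> perm_vector r l d \<pi> j)))) \<and>
     (\<exists>\<pi>. \<pi> permutes {1..r} \<and> gives_sylvester TYPE('k) r l d (perm_vector r l d \<pi>) \<and>
        (\<forall>m :: nat \<Rightarrow> int. gives_sylvester TYPE('k) r l d m \<longrightarrow>
           matrix_rows TYPE('k) r l d (perm_vector r l d \<pi>) \<le> matrix_rows TYPE('k) r l d m))"
proof -
  let ?syl = "gives_sylvester TYPE('k) r l d" and ?rows = "matrix_rows TYPE('k) r l d"
  let ?m = "perm_vector r l d"
  have syl_if: "?syl m" if "\<forall>j\<in>{1..r}. m j \<ge> ?m \<pi> j" for m \<pi>
    using assms(2,3) that by (intro gives_sylvester_if_ge_perm_vector) auto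
  have perm: "\<exists>\<pi>. \<pi> permutes {1..r} \<and> (\<forall>j\<in>{1..r}. m j \<ge> ?m \<pi> j)" if "?syl m" for m
    using assms(2,3) that by (metis perm_vector_le_if_gives_sylvester)
  have rows: "?rows m = card (monomials r l m)" if "?syl m" for m
    using assms(2) that by (rule matrix_rows_eq_card_monomials)
  \<comment> \<open>The candidates are finitely many. Any other Sylvester-type \<open>m\<close>
    dominates some \<open>?m \<sigma>\<close>, and the monomial count is monotone.\<close>
  let ?R = "(\<lambda>\<pi>. ?rows (?m \<pi>)) ` {\<pi>. \<pi> permutes {1..r}}"
  have fin: "finite ?R" by (simp add: finite_permutations)
  moreover have "?R \<noteq> {}" using permutes_id by blast
  ultimately have "Min ?R \<in> ?R" by (rule Min_in)
  then obtain \<pi> where \<pi>: "\<pi> permutes {1..r}" "?rows (?m \<pi>) = Min ?R" by auto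
  have least: "?rows (?m \<pi>) \<le> ?rows (?m \<sigma>)" if "\<sigma> permutes {1..r}" for \<sigma>
    unfolding \<pi>(2) using that by (intro Min_le fin) auto
  have "?rows (?m \<pi>) \<le> ?rows m" if m: "?syl m" for m
  proof -
    obtain \<sigma> where \<sigma>: "\<sigma> permutes {1..r}" "\<forall>j\<in>{1..r}. m j \<ge> ?m \<sigma> j" using perm[OF m] by blast
    have "?rows (?m \<pi>) \<le> ?rows (?m \<sigma>)" using \<sigma> by (intro least)
    also have "\<dots> \<le> ?rows m"
      unfolding rows[OF m] rows[OF syl_if[of \<sigma> "?m \<sigma>", simplified]]
      using \<sigma> by (intro card_monomials_mono) auto
    finally show ?thesis .
  qed
  then show ?thesis using syl_if perm \<pi>(1) by (metis order_refl)
qed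

end
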